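(* Assume that $\bar x$ is an extended M-stationary point for the problem $\min_{x\in\mathbb{R}^n} f(x)$ subject to $F(x)\in\Omega$, that $f$ and $F$ are twice Fréchet differentiable at $\bar x$, and that for every nonzero critical direction $0\neq u\in\mathcal{C}(\bar x)$ one has $$u^T\nabla_x^2\mathcal{L}(\bar x,1,\lambda)u>0\quad\forall\lambda\in\Lambda^1(\bar x;u).$$ Then $\bar x$ is an essential local minimizer of second order.
   Context: Data: $f:\mathbb{R}^n\to\mathbb{R}$ and $F:\mathbb{R}^n\to\mathbb{R}^m$ are continuously differentiable, and $\Omega\subset\mathbb{R}^m$ is a union of finitely many convex polyhedra. $\nabla f(x)$ (row vector) and $\nabla F(x)$ denote Jacobians, $\nabla^2$ second derivatives. $\mathcal{L}(x,\lambda_0,\lambda)=\lambda_0f(x)+\lambda^TF(x)$. For a closed set $C\subset\mathbb{R}^d$ and $z\in C$: $T(z;C)=\{w : \exists\, w_k\to w,\ t_k\downarrow 0,\ z+t_kw_k\in C\}$ (contingent cone); $\hat N(z;C)=\{\xi : \limsup_{z'\to z,\ z'\in C}\xi^T(z'-z)/\|z'-z\|\le 0\}$ (Fréchet normal cone); both are $\emptyset$ if $z\notin C$. For $z\in C$ and $w\in\mathbb{R}^d$: $N(z;C;w)=\{\xi : \exists\, t_k\downarrow 0,\ w_k\to w,\ \xi_k\to\xi,\ \xi_k\in\hat N(z+t_kw_k;C)\ \forall k\}$ (Mordukhovich normal cone in direction $w$). Linearized cone: $T_{\rm lin}(\bar x)=\{u\in\mathbb{R}^n : \nabla F(\bar x)u\in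 T(F(\bar x);\Omega)\}$. Critical cone: $\mathcal{C}(\bar x)=\{u\in T_{\rm lin}(\bar x) : \nabla f(\bar x)u\le 0\}$. Multiplier set: $\Lambda^1(\bar x;u)=\{\lambda\in\mathbb{R}^m : \lambda\in N(F(\bar x);\Omega;\nabla F(\bar x)u),\ \nabla_x\mathcal{L}(\bar x,1,\lambda)=0\}$. A feasible point $\bar x$ (i.e. $F(\bar x)\in\Omega$) is extended M-stationary if $\Lambda^1(\bar x;u)\neq\emptyset$ for all $u\in\mathcal{C}(\bar x)$. It is an essential local minimizer of second order if there are a neighborhood $U$ of $\bar x$ and $\beta>0$ such that $\max\{f(x)-f(\bar x),{\rm d}(F(x),\Omega)\}\ge\beta\|x-\bar x\|^2$ for all $x\in U$. *)

theory Defs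
  imports "HOL-Analysis.Analysis"
begin

section \<open>Derivatives\<close>

definition continuously_differentiable ::
    "('a::real_normed_vector \<Rightarrow> 'b::real_normed_vector) \<Rightarrow> bool" where
  "continuously_differentiable g \<longleftrightarrow>
     (\<exists>g' :: 'a \<Rightarrow> 'a \<Rightarrow>\<^sub>L 'b.
        (\<forall>x. (g has_derivative blinfun_apply (g' x)) (at x)) \<and> continuous_on UNIV g')"

definition twice_frechet_differentiable_at ::
    "('a::real_normed_vector \<Rightarrow> 'b::real_normed_vector) \<Rightarrow> 'a \<Rightarrow> bool" where
  "twice_frechet_differentiable_at g x \<longleftrightarrow>
     (\<exists>g' :: 'a \<Rightarrow> 'a \<Rightarrow>\<^sub>L 'b.
        (\<forall>\<^sub>F y in nhds x. (g has_derivative blinfun_apply (g' y)) (at y)) \<and>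
        g' differentiable (at x))"

definition grad :: "(real ^ 'n \<Rightarrow> real) \<Rightarrow> real ^ 'n \<Rightarrow> real ^ 'n" where
  "grad g x = (\<chi> i. frechet_derivative g (at x) (axis i 1))"

definition hessian :: "(real ^ 'n \<Rightarrow> real) \<Rightarrow> real ^ 'n \<Rightarrow> real ^ 'n ^ 'n" where
  "hessian g x = jacobian (grad g) (at x)"

section \<open>Tangent and normal cones\<close>

definition contingent_cone :: "'a::real_normed_vector \<Rightarrow> 'a set \<Rightarrow> 'a set" where
  "contingent_cone z C =
     {w. z \<in> C \<and>
         (\<exists>(t :: nat \<Rightarrow> real) v. (\<forall>k. t k > 0) \<and> t \<longlonglongrightarrow> 0 \<and> v \<longlonglongrightarrow> w \<and>
            (\<forall>k. z + t k *\<^sub>R v k \<in> C))}"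

text \<open>
  The upper limit is taken in the extended reals, over points of \<open>C\<close> different from \<open>z\<close>.
  At an isolated point of \<open>C\<close> it is \<open>-\<infinity>\<close>, so there the normal cone is the whole space.
\<close>
definition frechet_normal_cone :: "'a::real_inner \<Rightarrow> 'a set \<Rightarrow> 'a set" where
  "frechet_normal_cone z C =
     {\<xi>. z \<in> C \<and>
         Limsup (at z within C) (\<lambda>z'. ereal (\<xi> \<bullet> (z' - z) / norm (z' - z))) \<le> 0}"

definition directional_normal_cone :: "'a::real_inner \<Rightarrow> 'a set \<Rightarrow> 'a \<Rightarrow> 'a set" where
  "directional_normal_cone z C w =
     {\<xi>. \<exists>(t :: nat \<Rightarrow> real) v \<eta>. (\<forall>k. t k > 0) \<and> t \<longlonglongrightarrow> 0 \<and> v \<longlonglongrightarrow> w \<and> \<eta> \<longlonglongrightarrow> \<xi> \<and>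
         (\<forall>k. \<eta> k \<in> frechet_normal_cone (z + t k *\<^sub>R v k) C)}"

definition finite_union_of_polyhedra :: "'a::euclidean_space set \<Rightarrow> bool" where
  "finite_union_of_polyhedra C \<longleftrightarrow>
     (\<exists>\<P>. finite \<P> \<and> (\<forall>P\<in>\<P>. polyhedron P) \<and> C = \<Union>\<P>)"

section \<open>The problem of minimizing \<open>f x\<close> subject to \<open>F x \<in> \<Omega>\<close>\<close>

definition lagrangian ::
    "(real ^ 'n \<Rightarrow> real) \<Rightarrow> (real ^ 'n \<Rightarrow> real ^ 'm) \<Rightarrow> real ^ 'n \<Rightarrow> real \<Rightarrow> real ^ 'm \<Rightarrow> real" where
  "lagrangian f F x l0 l = l0 * f x + l \<bullet> F x"

definition linearized_cone ::
    "(real ^ 'n \<Rightarrow> real ^ 'm) \<Rightarrow> (real ^ 'm) set \<Rightarrow> real ^ 'n \<Rightarrow> (real ^ 'n) set" where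
  "linearized_cone F \<Omega> x = {u. jacobian F (at x) *v u \<in> contingent_cone (F x) \<Omega>}"

definition critical_cone ::
    "(real ^ 'n \<Rightarrow> real) \<Rightarrow> (real ^ 'n \<Rightarrow> real ^ 'm) \<Rightarrow> (real ^ 'm) set \<Rightarrow> real ^ 'n \<Rightarrow>
     (real ^ 'n) set" where
  "critical_cone f F \<Omega> x = {u \<in> linearized_cone F \<Omega> x. grad f x \<bullet> u \<le> 0}"

definition multipliers ::
    "(real ^ 'n \<Rightarrow> real) \<Rightarrow> (real ^ 'n \<Rightarrow> real ^ 'm) \<Rightarrow> (real ^ 'm) set \<Rightarrow> real ^ 'n \<Rightarrow> real ^ 'n \<Rightarrow>
     (real ^ 'm) set" where
  "multipliers f F \<Omega> x u =
     {l. l \<in> directional_normal_cone (F x) \<Omega> (jacobian F (at x) *v u) \<and>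
         grad (\<lambda>y. lagrangian f F y 1 l) x = 0}"

definition extended_M_stationary ::
    "(real ^ 'n \<Rightarrow> real) \<Rightarrow> (real ^ 'n \<Rightarrow> real ^ 'm) \<Rightarrow> (real ^ 'm) set \<Rightarrow> real ^ 'n \<Rightarrow> bool" where
  "extended_M_stationary f F \<Omega> x \<longleftrightarrow>
     F x \<in> \<Omega> \<and> (\<forall>u \<in> critical_cone f F \<Omega> x. multipliers f F \<Omega> x u \<noteq> {})"

definition essential_local_minimizer_second_order ::
    "(real ^ 'n \<Rightarrow> real) \<Rightarrow> (real ^ 'n \<Rightarrow> real ^ 'm) \<Rightarrow> (real ^ 'm) set \<Rightarrow> real ^ 'n \<Rightarrow> bool" where
  "essential_local_minimizer_second_order f F \<Omega> x \<longleftrightarrow>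
     F x \<in> \<Omega> \<and>
     (\<exists>U \<beta>. open U \<and> x \<in> U \<and> \<beta> > 0 \<and>
        (\<forall>y\<in>U. max (f y - f x) (infdist (F y) \<Omega>) \<ge> \<beta> * (norm (y - x))\<^sup>2))"

end

theory Submission
  imports Defs
begin

text \<open>
  If \<open>xbar\<close> is not an essential minimizer of second order, there are points
  \<open>xbar + t k *\<^sub>R v k\<close> with \<open>v k \<longlonglongrightarrow> u\<close> violating the growth condition; \<open>u\<close> is critical. Near
  \<open>F xbar\<close> the set \<open>\<Omega>\<close> is a finite union of polyhedral cones, and so is the tangent cone near the
  direction \<open>w = F' u\<close>; call the second local cone \<open>K\<close>. Expanding to second order, the
  \<open>z = (v k - u) / t k\<close> are approximate solutions of \<open>F' z + p \<in> K\<close>, \<open>f' z + s \<le> 0\<close> with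
  \<open>p = F''(u, u) / 2\<close>, \<open>s = f''(u, u) / 2\<close>.

  Directional normals are orthogonal to their direction, so extended M-stationarity says that
  \<open>f'\<close> is nonnegative on the linearized cone. Hence the linear disjunctive program of minimizing
  \<open>f' z\<close> subject to \<open>F' z + p \<in> K\<close> is bounded below. Penalizing the constraint quadratically and
  letting the penalty parameter grow produces multipliers \<open>l\<close> in Frechet normal cones of \<open>K\<close>. There
  are only finitely many of these cones and all are polyhedral, so one of them contains an exact
  multiplier with \<open>l \<bullet> p + s \<le> 0\<close>. It belongs to the multiplier set for \<open>u\<close> and contradicts the
  second-order condition.
\<close>

section \<open>Polyhedral cones\<close>

definition polar_cone :: "'a::real_inner set \<Rightarrow> 'a set" where
  "polar_cone S = {l. \<forall>v\<in>S. l \<bullet> v \<le> 0}"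

lemma convex_cone_polar_cone: "convex_cone (polar_cone S)"
  by (auto simp: polar_cone_def convex_cone_iff inner_add_left add_nonpos_nonpos mult_nonneg_nonpos)

text \<open>The separating hyperplane can be moved through the origin: its level \<open>b\<close> is
  negative because the cone contains 0, and a point of the cone with
  \<open>d \<bullet> y < 0\<close> could be rescaled to the value \<open>b\<close> itself, which
  strict separation excludes.\<close>

lemma separate_from_closed_convex_cone:
  fixes C :: "'a::euclidean_space set"
  assumes "convex_cone C" "closed C" "x \<notin> C"
  obtains d where "d \<bullet> x > 0" "\<And>y. y \<in> C \<Longrightarrow> d \<bullet> y \<le> 0"
proof -
  have "convex C" "C \<noteq> {}"
    using assms(1) by (auto simp: convex_cone_def)
  then obtain d b where d: "d \<bullet> x < b" "\<And>y. y \<in> C \<Longrightarrow> d \<bullet> y > b"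
    using separating_hyperplane_closed_point[of C x] assms by blast
  have b: "b < 0"
    using d(2)[of 0] convex_cone_contains_0[OF assms(1)] by simp
  have "d \<bullet> y \<ge> 0" if "y \<in> C" for y
  proof (rule ccontr)
    assume "\<not> d \<bullet> y \<ge> 0"
    then have neg: "d \<bullet> y < 0" by simp
    define c where "c = b / (d \<bullet> y)"
    have "c \<ge> 0"
      using neg b by (simp add: c_def divide_nonpos_neg)
    then have "c *\<^sub>R y \<in> C"
      using assms(1) that convex_cone_scaleR by blast
    then have "d \<bullet> (c *\<^sub>R y) > b"
      using d(2) by blast
    then show False
      using neg by (simp add: c_def)
  qed
  then show ?thesis
    using that[of "- d"] d(1) b by force
qed

text \<open>Farkas' lemma in geometric form: the finitely generated cone is closed, and a vector
  separating \<open>l\<close> from it satisfies all the defining inequalities while its product with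
  \<open>l\<close> is positive.\<close>

lemma polar_cone_halfspaces:
  fixes A :: "'a::euclidean_space set"
  assumes "finite A"
  shows "polar_cone {x. \<forall>a\<in>A. a \<bullet> x \<le> 0} = convex_cone hull A"
proof
  show "convex_cone hull A \<subseteq> polar_cone {x. \<forall>a\<in>A. a \<bullet> x \<le> 0}"
    by (intro hull_minimal convex_cone_polar_cone) (auto simp: polar_cone_def)
  show "polar_cone {x. \<forall>a\<in>A. a \<bullet> x \<le> 0} \<subseteq> convex_cone hull A"
  proof (rule subsetI, rule ccontr)
    fix l assume l: "l \<in> polar_cone {x. \<forall>a\<in>A. a \<bullet> x \<le> 0}" and "l \<notin> convex_cone hull A"
    then obtain d where d: "d \<bullet> l > 0" "\<And>y. y \<in> convex_cone hull A \<Longrightarrow> d \<bullet> y \<le> 0"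
      using separate_from_closed_convex_cone[OF convex_cone_convex_cone_hull closed_convex_cone_hull[OF assms]]
      by metis
    then have "\<forall>a\<in>A. a \<bullet> d \<le> 0"
      by (metis hull_inc inner_commute)
    then have "l \<bullet> d \<le> 0"
      using l by (auto simp: polar_cone_def)
    then show False
      using d(1) by (simp add: inner_commute)
  qed
qed

text \<open>Scaling removes the right-hand sides: \<open>b h \<ge> 0\<close> because the cone
  contains 0, and a point with \<open>a h \<bullet> x > 0\<close> would leave \<open>h\<close> when
  stretched.\<close>

lemma polyhedral_cone_halfspaces:
  assumes "polyhedron P" "convex_cone P"
  obtains A where "finite A" "P = {x. \<forall>a\<in>A. a \<bullet> x \<le> 0}"
proof -
  obtain F a b where F: "finite F" "P = \<Inter>F"
      and ab: "\<And>h. h \<in> F \<Longrightarrow> h = {x. a h \<bullet> x \<le> b h}"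
    using assms(1) unfolding polyhedron_def by metis
  have b: "b h \<ge> 0" if "h \<in> F" for h
  proof -
    have "0 \<in> h"
      using convex_cone_contains_0[OF assms(2)] F(2) that by blast
    then have "0 \<in> {x. a h \<bullet> x \<le> b h}"
      using ab[OF that] by metis
    then show ?thesis
      by simp
  qed
  have "a h \<bullet> x \<le> 0" if "h \<in> F" "x \<in> P" for h x
  proof (rule ccontr)
    assume "\<not> a h \<bullet> x \<le> 0"
    then have pos: "a h \<bullet> x > 0" by simp
    define c where "c = (b h + 1) / (a h \<bullet> x)"
    have "c \<ge> 0"
      using pos b[OF that(1)] by (simp add: c_def)
    then have "c *\<^sub>R x \<in> h"
      using that F(2) convex_cone_scaleR[OF assms(2)] by blast
    then have "c *\<^sub>R x \<in> {x. a h \<bullet> x \<le> b h}"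
      using ab[OF that(1)] by metis
    then have "a h \<bullet> (c *\<^sub>R x) \<le> b h"
      by simp
    then show False
      using pos by (simp add: c_def)
  qed
  moreover have "x \<in> P" if "\<forall>h\<in>F. a h \<bullet> x \<le> 0" for x
  proof -
    have "x \<in> {x. a h \<bullet> x \<le> b h}" if "h \<in> F" for h
      using that b[OF that] \<open>\<forall>h\<in>F. a h \<bullet> x \<le> 0\<close> by force
    then have "x \<in> h" if "h \<in> F" for h
      using ab that by metis
    then show ?thesis
      using F(2) by blast
  qed
  ultimately show ?thesis
    using F(1) by (intro that[of "a ` F"]) auto
qed

lemma polyhedron_polar_cone:
  fixes P :: "'a::euclidean_space set"
  assumes "polyhedron P" "convex_cone P"
  shows "polyhedron (polar_cone P)"
proof -
  obtain A where "finite A" "P = {x. \<forall>a\<in>A. a \<bullet> x \<le> 0}"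
    using polyhedral_cone_halfspaces assms by blast
  then show ?thesis
    by (simp add: polar_cone_halfspaces polyhedron_convex_cone_hull)
qed

lemma polar_cone_polar_cone:
  fixes P :: "'a::euclidean_space set"
  assumes "polyhedron P" "convex_cone P"
  shows "polar_cone (polar_cone P) = P"
proof
  show "P \<subseteq> polar_cone (polar_cone P)"
    by (auto simp: polar_cone_def inner_commute)
  obtain A where A: "finite A" "P = {x. \<forall>a\<in>A. a \<bullet> x \<le> 0}"
    using polyhedral_cone_halfspaces assms by blast
  then have "A \<subseteq> polar_cone P"
    by (auto simp: polar_cone_def)
  then show "polar_cone (polar_cone P) \<subseteq> P"
    using A(2) by (auto simp: polar_cone_def inner_commute)
qed

text \<open>One half of the Minkowski-Weyl theorem, by duality: the normals of halfspaces cutting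
  out the polar cone generate the original cone.\<close>

lemma polyhedral_cone_finitely_generated:
  fixes P :: "'a::euclidean_space set"
  assumes "polyhedron P" "convex_cone P"
  obtains B where "finite B" "P = convex_cone hull B"
proof -
  obtain B where B: "finite B" "polar_cone P = {x. \<forall>b\<in>B. b \<bullet> x \<le> 0}"
    using polyhedral_cone_halfspaces polyhedron_polar_cone[OF assms] convex_cone_polar_cone by blast
  then have "P = convex_cone hull B"
    using polar_cone_halfspaces[OF B(1)] polar_cone_polar_cone[OF assms] by simp
  then show ?thesis
    using that B(1) by blast
qed

text \<open>Linear images of closed convex cones can fail to be closed; here the image is generated
  by the images of finitely many generators.\<close>

lemma closed_linear_image_polyhedral_cone:
  fixes T :: "'a::euclidean_space \<Rightarrow> 'b::euclidean_space"
  assumes "polyhedron P" "convex_cone P" "linear T"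
  shows "closed (T ` P)"
proof -
  obtain B where B: "finite B" "P = convex_cone hull B"
    using polyhedral_cone_finitely_generated assms by blast
  then have "T ` P = convex_cone hull (T ` B)"
    using convex_cone_hull_linear_image[OF assms(3)] by metis
  then show ?thesis
    using B(1) by (simp add: closed_convex_cone_hull)
qed

text \<open>The points \<open>x n\<close> may be unbounded, so compactness does not help; closedness
  of a finitely generated cone provides \<open>p\<close>. This later turns approximate multipliers
  into an exact one.\<close>

lemma polyhedral_cone_limit:
  fixes T :: "'a::euclidean_space \<Rightarrow> 'b::euclidean_space" and \<tau> :: "'a \<Rightarrow> real"
  assumes P: "polyhedron P" "convex_cone P" and T: "linear T" and \<tau>: "linear \<tau>"
    and x: "\<And>n. x n \<in> P" "(\<lambda>n. T (x n)) \<longlonglongrightarrow> y"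
    and \<sigma>: "\<And>n. \<tau> (x n) \<le> \<sigma> n" "\<sigma> \<longlonglongrightarrow> c"
  shows "\<exists>p\<in>P. T p = y \<and> \<tau> p \<le> c"
proof -
  obtain B where B: "finite B" "P = convex_cone hull B"
    using polyhedral_cone_finitely_generated P by blast
  define L where "L p = (T p, \<tau> p)" for p
  have L: "linear L"
    using T \<tau> by (auto simp: L_def linear_iff)
  \<comment> \<open>An epigraph instead of an image: the extra generator \<open>(0, 1)\<close>
    admits every \<open>(T p, c)\<close> with \<open>\<tau> p \<le> c\<close>, and the cone stays
    finitely generated, hence closed.\<close>
  define C where "C = convex_cone hull (L ` B \<union> {(0, 1)})"
  have C: "C = (\<Union>u \<in> L ` P. \<Union>v \<in> convex_cone hull {(0, 1)}. {u + v})"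
    using convex_cone_hull_linear_image[OF L] by (simp add: C_def B(2) convex_cone_hull_Un del: Un_insert_right)
  have "convex_cone ({0} \<times> {0::real..})"
    by (auto simp: convex_cone_iff zero_prod_def)
  then have ray: "convex_cone hull {(0, 1)} \<subseteq> {0::'b} \<times> {0::real..}"
    by (intro hull_minimal) auto
  have mem: "(T (x n), \<sigma> n) \<in> C" for n
  proof -
    have "(\<sigma> n - \<tau> (x n)) *\<^sub>R (0::'b, 1::real) \<in> convex_cone hull {(0, 1)}"
      using \<sigma>(1)[of n] by (intro convex_cone_hull_mul hull_inc) auto
    moreover have "(T (x n), \<sigma> n) = L (x n) + (\<sigma> n - \<tau> (x n)) *\<^sub>R (0, 1)"
      by (simp add: L_def)
    ultimately show ?thesis
      using x(1)[of n] unfolding C by blast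
  qed
  have "closed C"
    unfolding C_def using B(1) by (intro closed_convex_cone_hull) auto
  then have "(y, c) \<in> C"
    using mem tendsto_Pair[OF x(2) \<sigma>(2)] by (rule closed_sequentially)
  then obtain p v where pv: "p \<in> P" "v \<in> convex_cone hull {(0, 1)}" "(y, c) = L p + v"
    unfolding C by blast
  moreover have "fst v = 0" "snd v \<ge> 0"
    using ray pv(2) by auto
  ultimately have "T p = y" "\<tau> p \<le> c"
    by (auto simp: L_def prod_eq_iff)
  then show ?thesis
    using pv(1) by blast
qed

text \<open>If \<open>- a\<close> were outside the closed image of the polar cone under the adjoint,
  a separating \<open>d\<close> would have \<open>A d\<close> in the bipolar cone, which is
  \<open>P\<close>, although \<open>a \<bullet> d < 0\<close>.\<close>

lemma polyhedral_farkas: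
  fixes A :: "'a::euclidean_space \<Rightarrow> 'b::euclidean_space"
  assumes A: "linear A" and P: "polyhedron P" "convex_cone P"
    and nonneg: "\<And>z. A z \<in> P \<Longrightarrow> a \<bullet> z \<ge> 0"
  shows "\<exists>l\<in>polar_cone P. \<forall>z. a \<bullet> z + l \<bullet> A z = 0"
proof -
  note pol = polyhedron_polar_cone[OF P] convex_cone_polar_cone[of P]
  have lin: "linear (adjoint A)"
    using A by (rule adjoint_linear)
  have "- a \<in> adjoint A ` polar_cone P"
  proof (rule ccontr)
    assume "- a \<notin> adjoint A ` polar_cone P"
    then obtain d where d: "d \<bullet> (- a) > 0" "\<And>y. y \<in> adjoint A ` polar_cone P \<Longrightarrow> d \<bullet> y \<le> 0"
      using separate_from_closed_convex_cone[of "adjoint A ` polar_cone P" "- a"]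
        closed_linear_image_polyhedral_cone[OF pol lin] convex_cone_linear_image pol(2) lin by blast
    have "A d \<bullet> l \<le> 0" if "l \<in> polar_cone P" for l
      using d(2)[of "adjoint A l"] that adjoint_works[OF A] by auto
    then have "A d \<in> polar_cone (polar_cone P)"
      by (simp add: polar_cone_def)
    then have "A d \<in> P"
      using polar_cone_polar_cone[OF P] by simp
    then show False
      using nonneg[of d] d(1) by (simp add: inner_commute)
  qed
  then obtain l where "l \<in> polar_cone P" "- a = adjoint A l"
    by blast
  moreover from this have "a \<bullet> z + l \<bullet> A z = 0" for z
    using adjoint_clauses(2)[OF A, of l z] by (simp flip: \<open>- a = adjoint A l\<close>)
  ultimately show ?thesis
    by blast
qed

section \<open>Local cones and normal cones of unions of polyhedra\<close>

text \<open>The constraints active at \<open>y\<close> cut out the local cone; the inactive ones,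
  being finitely many, stay strict near \<open>y\<close>.\<close>

lemma polyhedron_locally_cone:
  fixes P :: "'a::euclidean_space set"
  assumes "polyhedron P" "y \<in> P"
  obtains K r where "polyhedron K" "convex_cone K" "r > 0"
    "\<And>v. norm v < r \<Longrightarrow> y + v \<in> P \<longleftrightarrow> v \<in> K"
proof -
  obtain F a b where F: "finite F" "P = \<Inter>F"
      and nz: "\<And>h. h \<in> F \<Longrightarrow> a h \<noteq> 0" and ab: "\<And>h. h \<in> F \<Longrightarrow> h = {x. a h \<bullet> x \<le> b h}"
    using assms(1) unfolding polyhedron_def by metis
  have P: "x \<in> P \<longleftrightarrow> (\<forall>h\<in>F. a h \<bullet> x \<le> b h)" for x
  proof -
    have "x \<in> h \<longleftrightarrow> x \<in> {x. a h \<bullet> x \<le> b h}" if "h \<in> F" for h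
      using ab[OF that] by metis
    then show ?thesis
      using F(2) by auto
  qed
  define G where "G = {h\<in>F. a h \<bullet> y = b h}"
  define K where "K = \<Inter>((\<lambda>h. {x. a h \<bullet> x \<le> 0}) ` G)"
  have "finite G"
    using F(1) by (simp add: G_def)
  then have "polyhedron K"
    unfolding K_def by (intro polyhedron_Inter finite_imageI) (auto simp: polyhedron_halfspace_le)
  moreover have "convex_cone K"
    unfolding K_def by (intro convex_cone_Inter) (auto simp: convex_cone_halfspace_le)
  moreover have "\<exists>r>0. \<forall>v. norm v < r \<longrightarrow> (y + v \<in> P \<longleftrightarrow> v \<in> K)"
  proof -
    have "\<forall>\<^sub>F v in nhds 0. \<forall>h\<in>F - G. a h \<bullet> (y + v) < b h"
    proof (rule eventually_ball_finite)
      show "\<forall>h\<in>F - G. \<forall>\<^sub>F v in nhds 0. a h \<bullet> (y + v) < b h"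
      proof
        fix h assume h: "h \<in> F - G"
        then have lt: "a h \<bullet> y < b h"
          using P assms(2) by (force simp: G_def)
        have "((\<lambda>v. a h \<bullet> (y + v)) \<longlongrightarrow> a h \<bullet> (y + 0)) (nhds 0)"
          by (intro tendsto_intros filterlim_ident)
        then show "\<forall>\<^sub>F v in nhds 0. a h \<bullet> (y + v) < b h"
          using lt by (intro order_tendstoD) auto
      qed
    qed (use F in auto)
    then obtain r where r: "r > 0" "\<And>v h. norm v < r \<Longrightarrow> h \<in> F - G \<Longrightarrow> a h \<bullet> (y + v) < b h"
      unfolding eventually_nhds_metric by (auto simp: dist_norm)
    have "y + v \<in> P \<longleftrightarrow> v \<in> K" if "norm v < r" for v
    proof -
      have "a h \<bullet> (y + v) \<le> b h \<longleftrightarrow> (h \<in> G \<longrightarrow> a h \<bullet> v \<le> 0)" if "h \<in> F" for h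
        using r(2)[OF \<open>norm v < r\<close>, of h] that by (cases "h \<in> G") (auto simp: G_def inner_add_right)
      then show ?thesis
        unfolding P K_def by (auto simp: G_def)
    qed
    then show ?thesis
      using r(1) by blast
  qed
  ultimately show ?thesis
    using that by blast
qed

text \<open>Polyhedra that miss \<open>y\<close> are closed and disappear nearby; the others are
  replaced by their local cones, with a common radius by finiteness. For \<open>y \<notin> C\<close>
  the family is empty.\<close>

lemma union_of_polyhedra_locally_cone:
  fixes C :: "'a::euclidean_space set"
  assumes "finite_union_of_polyhedra C"
  obtains \<K> r where "finite \<K>" "\<And>P. P \<in> \<K> \<Longrightarrow> polyhedron P" "\<And>P. P \<in> \<K> \<Longrightarrow> convex_cone P"
    "r > 0" "\<And>v. norm v < r \<Longrightarrow> y + v \<in> C \<longleftrightarrow> v \<in> \<Union>\<K>"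
proof -
  obtain \<P> where P: "finite \<P>" "\<And>P. P \<in> \<P> \<Longrightarrow> polyhedron P" "C = \<Union>\<P>"
    using assms by (auto simp: finite_union_of_polyhedra_def)
  define Q where "Q = {P\<in>\<P>. y \<in> P}"
  have "\<exists>K. polyhedron K \<and> convex_cone K \<and> (\<exists>r>0. \<forall>v. norm v < r \<longrightarrow> (y + v \<in> P \<longleftrightarrow> v \<in> K))"
    if "P \<in> Q" for P
    using polyhedron_locally_cone[of P y] that P(2) unfolding Q_def by (metis (no_types, lifting) mem_Collect_eq)
  then obtain K where K: "\<And>P. P \<in> Q \<Longrightarrow> polyhedron (K P)" "\<And>P. P \<in> Q \<Longrightarrow> convex_cone (K P)"
      and loc: "\<And>P. P \<in> Q \<Longrightarrow> \<exists>r>0. \<forall>v. norm v < r \<longrightarrow> (y + v \<in> P \<longleftrightarrow> v \<in> K P)"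
    by metis
  have "\<forall>\<^sub>F v in nhds 0. \<forall>P\<in>\<P>. y + v \<in> P \<longleftrightarrow> P \<in> Q \<and> v \<in> K P"
  proof (rule eventually_ball_finite)
    show "\<forall>P\<in>\<P>. \<forall>\<^sub>F v in nhds 0. y + v \<in> P \<longleftrightarrow> P \<in> Q \<and> v \<in> K P"
    proof
      fix P assume P': "P \<in> \<P>"
      show "\<forall>\<^sub>F v in nhds 0. y + v \<in> P \<longleftrightarrow> P \<in> Q \<and> v \<in> K P"
      proof (cases "P \<in> Q")
        case True
        then show ?thesis
          using loc[OF True] unfolding eventually_nhds_metric by (auto simp: dist_norm)
      next
        case False
        then have "y \<in> - P" "open (- P)"
          using P' P(2) polyhedron_imp_closed by (auto simp: Q_def)
        moreover have "((\<lambda>v. y + v) \<longlongrightarrow> y + 0) (nhds 0)"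
          by (intro tendsto_intros filterlim_ident)
        ultimately have "\<forall>\<^sub>F v in nhds 0. y + v \<in> - P"
          using topological_tendstoD by fastforce
        then show ?thesis
          by (rule eventually_mono) (use False in auto)
      qed
    qed
  qed (use P in auto)
  then obtain r where r: "r > 0" "\<And>v P. norm v < r \<Longrightarrow> P \<in> \<P> \<Longrightarrow> y + v \<in> P \<longleftrightarrow> P \<in> Q \<and> v \<in> K P"
    unfolding eventually_nhds_metric by (auto simp: dist_norm)
  show ?thesis
  proof (rule that[of "K ` Q" r])
    show "finite (K ` Q)"
      using P(1) by (simp add: Q_def)
    show "y + v \<in> C \<longleftrightarrow> v \<in> \<Union>(K ` Q)" if "norm v < r" for v
    proof -
      have "Q \<subseteq> \<P>" by (auto simp: Q_def)
      then show ?thesis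
        using r(2)[OF that] P(3) by blast
    qed
  qed (use K r in auto)
qed

section \<open>Frechet normals of finite unions of cones\<close>

lemma frechet_normal_cone_iff:
  "\<xi> \<in> frechet_normal_cone z C \<longleftrightarrow>
     z \<in> C \<and> (\<forall>\<epsilon>>0. \<exists>\<delta>>0. \<forall>v. norm v < \<delta> \<and> z + v \<in> C \<longrightarrow> \<xi> \<bullet> v \<le> \<epsilon> * norm v)"
proof -
  have "Limsup (at z within C) (\<lambda>z'. ereal (\<xi> \<bullet> (z' - z) / norm (z' - z))) \<le> 0 \<longleftrightarrow>
      (\<forall>\<epsilon>>0. \<exists>\<delta>>0. \<forall>v. norm v < \<delta> \<and> z + v \<in> C \<longrightarrow> \<xi> \<bullet> v \<le> \<epsilon> * norm v)" (is "?L \<longleftrightarrow> ?R")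
  proof
    assume ?L
    show ?R
    proof (intro allI impI)
      fix \<epsilon> :: real assume "\<epsilon> > 0"
      then have "\<forall>\<^sub>F z' in at z within C. ereal (\<xi> \<bullet> (z' - z) / norm (z' - z)) < ereal \<epsilon>"
        using \<open>?L\<close> unfolding Limsup_le_iff by (auto simp del: less_ereal.simps)
      then obtain \<delta> where \<delta>: "\<delta> > 0"
          "\<And>z'. z' \<in> C \<Longrightarrow> z' \<noteq> z \<Longrightarrow> dist z' z < \<delta> \<Longrightarrow> \<xi> \<bullet> (z' - z) / norm (z' - z) < \<epsilon>"
        unfolding eventually_at by auto
      have "\<xi> \<bullet> v \<le> \<epsilon> * norm v" if "norm v < \<delta>" "z + v \<in> C" for v
        using \<delta>(2)[of "z + v"] that by (cases "v = 0") (auto simp: dist_norm divide_simps)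
      then show "\<exists>\<delta>>0. \<forall>v. norm v < \<delta> \<and> z + v \<in> C \<longrightarrow> \<xi> \<bullet> v \<le> \<epsilon> * norm v"
        using \<delta>(1) by blast
    qed
  next
    assume R: ?R
    show ?L
      unfolding Limsup_le_iff
    proof (intro allI impI)
      fix y :: ereal assume "0 < y"
      then obtain \<epsilon> where \<epsilon>: "\<epsilon> > 0" "ereal \<epsilon> < y"
        using ereal_dense2 by (metis ereal_less(2))
      obtain \<delta> where \<delta>: "\<delta> > 0" "\<And>v. norm v < \<delta> \<Longrightarrow> z + v \<in> C \<Longrightarrow> \<xi> \<bullet> v \<le> \<epsilon> * norm v"
        using R \<epsilon>(1) by blast
      have "ereal (\<xi> \<bullet> (z' - z) / norm (z' - z)) < y" if "z' \<in> C" "z' \<noteq> z" "dist z' z < \<delta>" for z'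
      proof -
        have "\<xi> \<bullet> (z' - z) / norm (z' - z) \<le> \<epsilon>"
          using \<delta>(2)[of "z' - z"] that by (auto simp: dist_norm divide_simps)
        then show ?thesis
          using \<epsilon>(2) by (metis ereal_less_eq(3) le_less_trans)
      qed
      then show "\<forall>\<^sub>F z' in at z within C. ereal (\<xi> \<bullet> (z' - z) / norm (z' - z)) < y"
        unfolding eventually_at using \<delta>(1) by auto
    qed
  qed
  then show ?thesis
    by (simp add: frechet_normal_cone_def)
qed

lemma frechet_normal_cone_local:
  assumes "r > 0" and loc: "\<And>v. norm v < r \<Longrightarrow> z + v \<in> C \<longleftrightarrow> z' + v \<in> C'"
  shows "frechet_normal_cone z C = frechet_normal_cone z' C'"
proof -
  have *: "frechet_normal_cone z C \<subseteq> frechet_normal_cone z' C'"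
    if loc: "\<And>v. norm v < r \<Longrightarrow> z + v \<in> C \<longleftrightarrow> z' + v \<in> C'" for z z' :: 'a and C C'
  proof
    fix \<xi> assume \<xi>: "\<xi> \<in> frechet_normal_cone z C"
    show "\<xi> \<in> frechet_normal_cone z' C'"
      unfolding frechet_normal_cone_iff
    proof (intro conjI allI impI)
      show "z' \<in> C'"
        using \<xi> loc[of 0] \<open>r > 0\<close> by (simp add: frechet_normal_cone_iff)
      fix \<epsilon> :: real assume "\<epsilon> > 0"
      then obtain \<delta> where "\<delta> > 0" "\<And>v. norm v < \<delta> \<Longrightarrow> z + v \<in> C \<Longrightarrow> \<xi> \<bullet> v \<le> \<epsilon> * norm v"
        using \<xi> unfolding frechet_normal_cone_iff by blast
      then show "\<exists>\<delta>>0. \<forall>v. norm v < \<delta> \<and> z' + v \<in> C' \<longrightarrow> \<xi> \<bullet> v \<le> \<epsilon> * norm v"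
        using loc \<open>r > 0\<close> by (intro exI[of _ "min \<delta> r"]) auto
    qed
  qed
  show ?thesis
    using *[of z C z' C'] *[of z' C' z C] loc by blast
qed

lemma frechet_normal_cone_local_cone:
  assumes loc: "\<And>v. norm v < r \<Longrightarrow> y + v \<in> C \<longleftrightarrow> v \<in> T" and "norm v < r"
  shows "frechet_normal_cone (y + v) C = frechet_normal_cone v T"
proof (rule frechet_normal_cone_local[where r = "r - norm v"])
  fix u :: 'a assume "norm u < r - norm v"
  then have "norm (v + u) < r"
    using norm_triangle_ineq[of v u] by linarith
  then show "y + v + u \<in> C \<longleftrightarrow> v + u \<in> T"
    using loc[of "v + u"] by (simp add: add.assoc)
qed (use assms(2) in simp)

text \<open>Near \<open>k\<close> only the cones containing \<open>k\<close> matter, the others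
  being closed and finitely many. For such a cone \<open>P\<close>, the elements of \<open>P\<close>
  and also \<open>- k\<close> are directions in which short steps from \<open>k\<close> stay in
  \<open>P\<close>; this yields polarity and orthogonality to \<open>k\<close>.\<close>

lemma frechet_normal_cone_Union:
  fixes \<K> :: "'a::euclidean_space set set"
  assumes fin: "finite \<K>" and cl: "\<And>P. P \<in> \<K> \<Longrightarrow> closed P" and cc: "\<And>P. P \<in> \<K> \<Longrightarrow> convex_cone P"
    and k: "k \<in> \<Union>\<K>"
  shows "frechet_normal_cone k (\<Union>\<K>) = (\<Inter>P\<in>{P\<in>\<K>. k \<in> P}. polar_cone P \<inter> {l. l \<bullet> k = 0})"
proof (rule set_eqI, rule iffI)
  fix l assume l: "l \<in> frechet_normal_cone k (\<Union>\<K>)"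
  \<comment> \<open>Test the definition of a normal on the short step \<open>t *\<^sub>R v\<close>,
    divide by \<open>t\<close>, and let \<open>\<epsilon>\<close> tend to 0.\<close>
  have le: "l \<bullet> v \<le> 0" if "r > 0" and v: "\<And>t. 0 < t \<Longrightarrow> t < r \<Longrightarrow> k + t *\<^sub>R v \<in> \<Union>\<K>" for r v
  proof -
    have "l \<bullet> v \<le> \<epsilon> * norm v" if "\<epsilon> > 0" for \<epsilon>
    proof -
      obtain \<delta> where \<delta>: "\<delta> > 0" "\<And>v. norm v < \<delta> \<Longrightarrow> k + v \<in> \<Union>\<K> \<Longrightarrow> l \<bullet> v \<le> \<epsilon> * norm v"
        using l \<open>\<epsilon> > 0\<close> unfolding frechet_normal_cone_iff by meson
      define t where "t = min (r / 2) (\<delta> / (2 * (norm v + 1)))"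
      have t: "0 < t" "t < r" "t \<le> \<delta> / (2 * (norm v + 1))"
        using \<open>r > 0\<close> \<delta>(1) norm_ge_zero[of v] by (auto simp: t_def add_nonneg_pos intro!: divide_pos_pos)
      have "t * norm v \<le> \<delta> / (2 * (norm v + 1)) * (norm v + 1)"
        using t by (intro mult_mono) auto
      also have "\<dots> = \<delta> / 2"
        using add_nonneg_pos[OF norm_ge_zero[of v] zero_less_one] by (simp add: divide_simps)
      finally have "norm (t *\<^sub>R v) < \<delta>"
        using t(1) \<delta>(1) by simp
      then have "l \<bullet> (t *\<^sub>R v) \<le> \<epsilon> * norm (t *\<^sub>R v)"
        by (rule \<delta>(2)[OF _ v[OF t(1,2)]])
      then have "t * (l \<bullet> v) \<le> t * (\<epsilon> * norm v)"
        using t(1) by (simp add: ac_simps)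
      then show ?thesis
        using t(1) by simp
    qed
    then have "((\<lambda>\<epsilon>. \<epsilon> * norm v) \<longlongrightarrow> 0 * norm v) (at_right 0) \<Longrightarrow> l \<bullet> v \<le> 0 * norm v"
      by (intro tendsto_lowerbound[where f = "\<lambda>\<epsilon>. \<epsilon> * norm v" and F = "at_right 0"])
        (auto simp: eventually_at_right_field intro!: exI[of _ 1])
    moreover have "((\<lambda>\<epsilon>. \<epsilon> * norm v) \<longlongrightarrow> 0 * norm v) (at_right (0::real))"
      by (intro tendsto_intros)
    ultimately show ?thesis by simp
  qed
  show "l \<in> (\<Inter>P\<in>{P\<in>\<K>. k \<in> P}. polar_cone P \<inter> {l. l \<bullet> k = 0})"
  proof (rule INT_I)
    fix P assume "P \<in> {P\<in>\<K>. k \<in> P}"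
    then have P: "P \<in> \<K>" "k \<in> P"
      by auto
    have "l \<bullet> v \<le> 0" if "v \<in> P" for v
    proof (rule le[of 1])
      fix t :: real assume "0 < t"
      then have "k + t *\<^sub>R v \<in> P"
        using cc[OF P(1)] P(2) that by (simp add: convex_cone_iff)
      then show "k + t *\<^sub>R v \<in> \<Union>\<K>"
        using P(1) by blast
    qed simp
    \<comment> \<open>Shrinking \<open>k\<close> towards the apex stays in \<open>P\<close>; this is
      the inequality opposite to \<open>l \<bullet> k \<le> 0\<close>.\<close>
    moreover have "l \<bullet> (- k) \<le> 0"
    proof (rule le[of 1])
      fix t :: real assume "0 < t" "t < 1"
      then have "(1 - t) *\<^sub>R k \<in> P"
        using cc[OF P(1)] P(2) by (simp add: convex_cone_iff)
      then show "k + t *\<^sub>R (- k) \<in> \<Union>\<K>"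
        using P(1) by (auto simp: algebra_simps)
    qed simp
    ultimately show "l \<in> polar_cone P \<inter> {l. l \<bullet> k = 0}"
      using P(2) by (auto simp: polar_cone_def intro: antisym)
  qed
next
  fix l assume l: "l \<in> (\<Inter>P\<in>{P\<in>\<K>. k \<in> P}. polar_cone P \<inter> {l. l \<bullet> k = 0})"
  have "closed (\<Union>{P\<in>\<K>. k \<notin> P})"
    using fin cl by (intro closed_Union) auto
  then have "open (- \<Union>{P\<in>\<K>. k \<notin> P})" "k \<in> - \<Union>{P\<in>\<K>. k \<notin> P}"
    by auto
  then obtain \<delta> where \<delta>: "\<delta> > 0" "ball k \<delta> \<subseteq> - \<Union>{P\<in>\<K>. k \<notin> P}"
    using open_contains_ball by blast
  have "l \<bullet> v \<le> 0" if v: "norm v < \<delta>" "k + v \<in> \<Union>\<K>" for v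
  proof -
    have "k + v \<in> ball k \<delta>"
      using v(1) by (simp add: dist_norm)
    then have "k + v \<notin> \<Union>{P\<in>\<K>. k \<notin> P}"
      using \<delta>(2) by blast
    then obtain P where P: "P \<in> \<K>" "k \<in> P" "k + v \<in> P"
      using v(2) by blast
    then have "l \<in> polar_cone P \<inter> {l. l \<bullet> k = 0}"
      using l by blast
    then have "l \<bullet> (k + v) \<le> 0" "l \<bullet> k = 0"
      using P(3) by (auto simp: polar_cone_def)
    then show ?thesis
      by (simp add: inner_add_right)
  qed
  then have "\<forall>v. norm v < \<delta> \<and> k + v \<in> \<Union>\<K> \<longrightarrow> l \<bullet> v \<le> \<epsilon> * norm v" if "\<epsilon> > 0" for \<epsilon>
    using that by (meson dual_order.trans less_imp_le mult_nonneg_nonneg norm_ge_zero)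
  then show "l \<in> frechet_normal_cone k (\<Union>\<K>)"
    unfolding frechet_normal_cone_iff using k \<delta>(1) by meson
qed

text \<open>Each of these cones is an intersection of faces of the polar cones, and a polyhedron has
  finitely many faces. Finiteness feeds the pigeonhole argument for multipliers.\<close>

lemma finite_frechet_normal_cones:
  fixes \<K> :: "'a::euclidean_space set set"
  assumes fin: "finite \<K>" and P: "\<And>P. P \<in> \<K> \<Longrightarrow> polyhedron P" "\<And>P. P \<in> \<K> \<Longrightarrow> convex_cone P"
  shows "finite ((\<lambda>k. frechet_normal_cone k (\<Union>\<K>)) ` \<Union>\<K>)"
proof -
  define \<F> where "\<F> = (\<Union>P\<in>\<K>. {F. F face_of polar_cone P})"
  have "finite \<F>"
    using fin P by (auto simp: \<F>_def polyhedron_polar_cone finite_polyhedron_faces)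
  have "polar_cone P \<inter> {l. l \<bullet> k = 0} face_of polar_cone P" if "P \<in> \<K>" "k \<in> P" for P k
    using face_of_Int_supporting_hyperplane_le[of "polar_cone P" k 0] convex_cone_polar_cone[of P] that
    by (auto simp: polar_cone_def convex_cone_def inner_commute)
  then have sub: "(\<lambda>P. polar_cone P \<inter> {l. l \<bullet> k = 0}) ` {P\<in>\<K>. k \<in> P} \<in> Pow \<F>" for k
    unfolding \<F>_def by blast
  have "frechet_normal_cone k (\<Union>\<K>) \<in> Inter ` Pow \<F>" if "k \<in> \<Union>\<K>" for k
  proof -
    have "frechet_normal_cone k (\<Union>\<K>) = (\<Inter>P\<in>{P\<in>\<K>. k \<in> P}. polar_cone P \<inter> {l. l \<bullet> k = 0})"
      using fin P that polyhedron_imp_closed by (intro frechet_normal_cone_Union) auto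
    then show ?thesis
      by (rule image_eqI[OF _ sub])
  qed
  then have "(\<lambda>k. frechet_normal_cone k (\<Union>\<K>)) ` \<Union>\<K> \<subseteq> Inter ` Pow \<F>"
    by blast
  then show ?thesis
    using \<open>finite \<F>\<close> finite_subset by blast
qed

lemma polyhedral_frechet_normal_cone:
  fixes \<K> :: "'a::euclidean_space set set"
  assumes fin: "finite \<K>" and P: "\<And>P. P \<in> \<K> \<Longrightarrow> polyhedron P" "\<And>P. P \<in> \<K> \<Longrightarrow> convex_cone P"
    and k: "k \<in> \<Union>\<K>"
  shows "polyhedron (frechet_normal_cone k (\<Union>\<K>))" "convex_cone (frechet_normal_cone k (\<Union>\<K>))"
proof -
  have eq: "frechet_normal_cone k (\<Union>\<K>) = (\<Inter>P\<in>{P\<in>\<K>. k \<in> P}. polar_cone P \<inter> {l. l \<bullet> k = 0})"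
    using fin P k polyhedron_imp_closed by (intro frechet_normal_cone_Union) auto
  have hyp: "polyhedron {l. l \<bullet> k = 0}" "convex_cone {l. l \<bullet> k = 0}"
    using polyhedron_hyperplane[of k 0] by (auto simp: inner_commute convex_cone_iff inner_add_right)
  show "polyhedron (frechet_normal_cone k (\<Union>\<K>))"
    unfolding eq using fin hyp(1) P
    by (intro polyhedron_Inter) (auto intro: polyhedron_polar_cone)
  have "convex_cone (polar_cone P \<inter> {l. l \<bullet> k = 0})" for P
    using convex_cone_polar_cone[of P] hyp(2) unfolding convex_cone_iff by blast
  then show "convex_cone (frechet_normal_cone k (\<Union>\<K>))"
    unfolding eq by (intro convex_cone_Inter) blast
qed

lemma frechet_normal_orthogonal:
  fixes \<K> :: "'a::euclidean_space set set"
  assumes "finite \<K>" "\<And>P. P \<in> \<K> \<Longrightarrow> closed P" "\<And>P. P \<in> \<K> \<Longrightarrow> convex_cone P"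
    and l: "l \<in> frechet_normal_cone k (\<Union>\<K>)"
  shows "l \<bullet> k = 0"
proof -
  have k: "k \<in> \<Union>\<K>"
    using l frechet_normal_cone_iff by metis
  then have "l \<in> (\<Inter>P\<in>{P\<in>\<K>. k \<in> P}. polar_cone P \<inter> {l. l \<bullet> k = 0})"
    using frechet_normal_cone_Union[OF assms(1-3) k] l by simp
  moreover obtain P where "P \<in> \<K>" "k \<in> P"
    using k by blast
  ultimately show ?thesis
    by blast
qed

text \<open>Near \<open>y\<close> the set is a translated cone, so every approximating normal
  \<open>\<eta> k\<close> is orthogonal to its base point and hence to \<open>v k\<close>; this
  passes to the limit.\<close>

lemma directional_normal_orthogonal:
  fixes C :: "'a::euclidean_space set"
  assumes C: "finite_union_of_polyhedra C" and l: "l \<in> directional_normal_cone y C w"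
  shows "l \<bullet> w = 0"
proof -
  obtain \<K> r where K: "finite \<K>" "\<And>P. P \<in> \<K> \<Longrightarrow> polyhedron P" "\<And>P. P \<in> \<K> \<Longrightarrow> convex_cone P"
      and r: "r > 0" "\<And>v. norm v < r \<Longrightarrow> y + v \<in> C \<longleftrightarrow> v \<in> \<Union>\<K>"
    using union_of_polyhedra_locally_cone[OF C] by metis
  obtain t :: "nat \<Rightarrow> real" and v \<eta> where t: "\<And>k. t k > 0" "t \<longlonglongrightarrow> 0" and v: "v \<longlonglongrightarrow> w" and \<eta>: "\<eta> \<longlonglongrightarrow> l"
      and N: "\<And>k. \<eta> k \<in> frechet_normal_cone (y + t k *\<^sub>R v k) C"
    using l unfolding directional_normal_cone_def by blast
  have "(\<lambda>k. norm (t k *\<^sub>R v k)) \<longlonglongrightarrow> norm (0 *\<^sub>R w)"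
    using t(2) v by (intro tendsto_intros)
  then have "\<forall>\<^sub>F k in sequentially. norm (t k *\<^sub>R v k) < r"
    using r(1) by (intro order_tendstoD) auto
  then have "\<forall>\<^sub>F k in sequentially. \<eta> k \<bullet> v k = 0"
  proof eventually_elim
    case (elim k)
    have "frechet_normal_cone (y + t k *\<^sub>R v k) C = frechet_normal_cone (t k *\<^sub>R v k) (\<Union>\<K>)"
      using r(2) elim by (rule frechet_normal_cone_local_cone)
    then have "\<eta> k \<in> frechet_normal_cone (t k *\<^sub>R v k) (\<Union>\<K>)"
      using N[of k] by simp
    then have "\<eta> k \<bullet> (t k *\<^sub>R v k) = 0"
      using K polyhedron_imp_closed by (intro frechet_normal_orthogonal[of \<K>]) auto
    then show ?case
      using t(1)[of k] by simp
  qed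
  moreover have "(\<lambda>k. \<eta> k \<bullet> v k) \<longlonglongrightarrow> l \<bullet> w"
    using \<eta> v by (rule tendsto_inner)
  ultimately have "(\<lambda>k. 0) \<longlonglongrightarrow> l \<bullet> w"
    using tendsto_cong by fast
  then show ?thesis
    using LIMSEQ_unique tendsto_const by blast
qed

text \<open>Dilation by \<open>c\<close> preserves both the set and the quotient in the definition;
  the reverse inclusion is the same argument with factor \<open>1 / c\<close>.\<close>

lemma frechet_normal_cone_scale:
  assumes C: "\<And>c v. c > 0 \<Longrightarrow> v \<in> C \<Longrightarrow> c *\<^sub>R v \<in> C" and "c > 0"
  shows "frechet_normal_cone (c *\<^sub>R z) C = frechet_normal_cone z C"
proof -
  have *: "frechet_normal_cone z C \<subseteq> frechet_normal_cone (c *\<^sub>R z) C" if "c > 0" for c z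
  proof
    fix \<xi> assume \<xi>: "\<xi> \<in> frechet_normal_cone z C"
    show "\<xi> \<in> frechet_normal_cone (c *\<^sub>R z) C"
      unfolding frechet_normal_cone_iff
    proof (intro conjI allI impI)
      show "c *\<^sub>R z \<in> C"
        using \<xi> C that by (simp add: frechet_normal_cone_iff)
      fix \<epsilon> :: real assume "\<epsilon> > 0"
      then obtain \<delta> where \<delta>: "\<delta> > 0" "\<And>v. norm v < \<delta> \<Longrightarrow> z + v \<in> C \<Longrightarrow> \<xi> \<bullet> v \<le> \<epsilon> * norm v"
        using \<xi> unfolding frechet_normal_cone_iff by blast
      have "\<xi> \<bullet> v \<le> \<epsilon> * norm v" if v: "norm v < c * \<delta>" "c *\<^sub>R z + v \<in> C" for v
      proof -
        have "(1 / c) *\<^sub>R (c *\<^sub>R z + v) \<in> C"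
          using v(2) \<open>c > 0\<close> by (intro C) auto
        then have "z + (1 / c) *\<^sub>R v \<in> C"
          using \<open>c > 0\<close> by (simp add: scaleR_add_right)
        moreover have "norm ((1 / c) *\<^sub>R v) < \<delta>"
          using v(1) \<open>c > 0\<close> by (simp add: field_simps)
        ultimately have "\<xi> \<bullet> ((1 / c) *\<^sub>R v) \<le> \<epsilon> * norm ((1 / c) *\<^sub>R v)"
          by (intro \<delta>(2))
        then show ?thesis
          using \<open>c > 0\<close> by (simp add: field_simps)
      qed
      then show "\<exists>\<delta>>0. \<forall>v. norm v < \<delta> \<and> c *\<^sub>R z + v \<in> C \<longrightarrow> \<xi> \<bullet> v \<le> \<epsilon> * norm v"
        using \<delta>(1) that by (intro exI[of _ "c * \<delta>"]) auto
    qed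
  qed
  have "frechet_normal_cone (c *\<^sub>R z) C \<subseteq> frechet_normal_cone ((1 / c) *\<^sub>R (c *\<^sub>R z)) C"
    using \<open>c > 0\<close> by (intro *) auto
  then show ?thesis
    using *[OF \<open>c > 0\<close>, of z] \<open>c > 0\<close> by simp
qed

lemma contingent_cone_local_cone:
  assumes loc: "\<And>v. norm v < r \<Longrightarrow> y + v \<in> C \<longleftrightarrow> v \<in> T" and "r > 0"
    and T: "closed T" "\<And>c v. c \<ge> 0 \<Longrightarrow> v \<in> T \<Longrightarrow> c *\<^sub>R v \<in> T"
  shows "contingent_cone y C = T"
proof (intro equalityI subsetI)
  fix w assume "w \<in> contingent_cone y C"
  then obtain t v where t: "\<And>k::nat. t k > (0::real)" "t \<longlonglongrightarrow> 0" "v \<longlonglongrightarrow> w" "\<And>k. y + t k *\<^sub>R v k \<in> C"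
    unfolding contingent_cone_def by blast
  have "(\<lambda>k. norm (t k *\<^sub>R v k)) \<longlonglongrightarrow> norm (0 *\<^sub>R w)"
    using t by (intro tendsto_intros)
  then have "\<forall>\<^sub>F k in sequentially. norm (t k *\<^sub>R v k) < r"
    using \<open>r > 0\<close> by (intro order_tendstoD) auto
  then have "\<forall>\<^sub>F k in sequentially. v k \<in> T"
  proof eventually_elim
    case (elim k)
    then have "t k *\<^sub>R v k \<in> T"
      using loc t(4) by blast
    then have "(1 / t k) *\<^sub>R t k *\<^sub>R v k \<in> T"
      by (rule T(2)[rotated]) (use t(1)[of k] in simp)
    moreover have "(1 / t k) *\<^sub>R t k *\<^sub>R v k = v k"
      using t(1)[of k] by simp
    ultimately show ?case
      by metis
  qed
  then show "w \<in> T"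
    using Lim_in_closed_set[OF T(1) _ sequentially_bot t(3)] by blast
next
  fix w assume w: "w \<in> T"
  \<comment> \<open>The last factor starts at 1/2, so even the first step stays strictly within
    radius \<open>r\<close>; the \<open>+ 1\<close> covers \<open>w = 0\<close>.\<close>
  define t where "t k = r / (norm w + 1) * inverse (real (Suc (Suc k)))" for k
  have pos: "norm w + 1 > 0"
    by (simp add: add_nonneg_pos)
  have t: "t k > 0" for k
    using pos \<open>r > 0\<close> by (simp add: t_def)
  have lim: "t \<longlonglongrightarrow> 0"
    unfolding t_def by (rule tendsto_mult_right_zero[OF LIMSEQ_Suc[OF LIMSEQ_inverse_real_of_nat]])
  have "y + t k *\<^sub>R w \<in> C" for k
  proof -
    have "t k < r / (norm w + 1) * 1"
      unfolding t_def using pos \<open>r > 0\<close> by (intro mult_strict_left_mono) (auto simp: field_simps)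
    then have "t k * (norm w + 1) < r"
      using pos by (simp add: field_simps)
    then have "norm (t k *\<^sub>R w) < r"
      using t[of k] by (simp add: algebra_simps)
    then show ?thesis
      using loc T(2) w t[of k] by (simp add: less_imp_le)
  qed
  moreover have "y \<in> C"
    using loc[of 0] T(2)[of 0 w] w \<open>r > 0\<close> by simp
  ultimately show "w \<in> contingent_cone y C"
    unfolding contingent_cone_def using t lim by (intro CollectI conjI exI[of _ t] exI[of _ "\<lambda>_. w"]) auto
qed

text \<open>Two localizations in succession: \<open>C\<close> at \<open>y\<close> looks like
  \<open>T\<close>, and \<open>T\<close> at \<open>w\<close> looks like \<open>K\<close>. Along
  points \<open>y + t i *\<^sub>R v i\<close>, with \<open>v i\<close> equal to \<open>w\<close>
  plus a shrinking multiple of \<open>k\<close>, locality and scaling invariance show that the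
  Frechet normal cone is always that of \<open>K\<close> at \<open>k\<close>, so the constant
  sequence \<open>l\<close> serves.\<close>

lemma directional_normal_of_local_cones:
  assumes T: "\<And>v. norm v < r \<Longrightarrow> y + v \<in> C \<longleftrightarrow> v \<in> T" "r > 0"
      "\<And>c v. c > 0 \<Longrightarrow> v \<in> T \<Longrightarrow> c *\<^sub>R v \<in> T"
    and K: "\<And>v. norm v < r' \<Longrightarrow> w + v \<in> T \<longleftrightarrow> v \<in> K" "r' > 0"
      "\<And>c v. c > 0 \<Longrightarrow> v \<in> K \<Longrightarrow> c *\<^sub>R v \<in> K"
    and l: "l \<in> frechet_normal_cone k K"
  shows "l \<in> directional_normal_cone y C w"
proof -
  define n where "n i = inverse (real (Suc (Suc i)))" for i
  have n: "n i > 0" "n i < 1" for i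
    by (auto simp: n_def field_simps)
  have n_lim: "n \<longlonglongrightarrow> 0"
    unfolding n_def using LIMSEQ_Suc[OF LIMSEQ_inverse_real_of_nat] by simp
  \<comment> \<open>This brings \<open>k\<close> within distance \<open>r'\<close> of the apex; the
    factors \<open>n i < 1\<close> make the bound strict.\<close>
  define c where "c = r' / (norm k + 1)"
  have posk: "norm k + 1 > 0"
    by (simp add: add_nonneg_pos)
  have c: "c > 0" "norm (c *\<^sub>R k) \<le> r'"
    using K(2) posk by (auto simp: c_def field_simps)
  define v where "v i = w + (n i * c) *\<^sub>R k" for i
  have small: "norm ((n i * c) *\<^sub>R k) < r'" for i
  proof -
    have "norm ((n i * c) *\<^sub>R k) = n i * norm (c *\<^sub>R k)"
      using n[of i] by (simp add: abs_mult)
    also have "\<dots> \<le> n i * r'"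
      using n[of i] c by (intro mult_left_mono) auto
    also have "\<dots> < r'"
      using n[of i] K(2) by simp
    finally show ?thesis .
  qed
  have v_lim: "v \<longlonglongrightarrow> w"
  proof -
    have "v \<longlonglongrightarrow> w + (0 * c) *\<^sub>R k"
      unfolding v_def by (intro tendsto_intros n_lim)
    then show ?thesis by simp
  qed
  \<comment> \<open>Since \<open>norm (v i) \<le> norm w + r'\<close>, this keeps every
    \<open>t i *\<^sub>R v i\<close> within radius \<open>r\<close>.\<close>
  define d where "d = r / (norm w + r' + 1)"
  have posw: "norm w + r' + 1 > 0"
    using K(2) by (simp add: add_nonneg_pos)
  have d: "d > 0" "d * (norm w + r') \<le> r"
    using T(2) posw by (auto simp: d_def field_simps)
  define t where "t i = n i * d" for i
  have t: "t i > 0" for i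
    using n d by (simp add: t_def)
  have t_lim: "t \<longlonglongrightarrow> 0"
    unfolding t_def using tendsto_mult_left_zero[OF n_lim] by simp
  have tv: "norm (t i *\<^sub>R v i) < r" for i
  proof -
    have "norm (v i) \<le> norm w + r'"
      using norm_triangle_ineq[of w "(n i * c) *\<^sub>R k"] small[of i] by (simp add: v_def)
    then have "d * norm (v i) \<le> d * (norm w + r')"
      using d(1) by (intro mult_left_mono) auto
    then have "d * norm (v i) \<le> r"
      using d(2) by linarith
    then have "n i * (d * norm (v i)) \<le> n i * r"
      using n[of i] by (intro mult_left_mono) auto
    also have "\<dots> < r"
      using n[of i] T(2) by simp
    finally show ?thesis
      using t[of i] by (simp add: t_def mult.assoc)
  qed
  have "l \<in> frechet_normal_cone (y + t i *\<^sub>R v i) C" for i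
  proof -
    have "frechet_normal_cone (y + t i *\<^sub>R v i) C = frechet_normal_cone (t i *\<^sub>R v i) T"
      using T(1) tv by (rule frechet_normal_cone_local_cone)
    also have "\<dots> = frechet_normal_cone (v i) T"
      using T(3) t by (rule frechet_normal_cone_scale)
    also have "\<dots> = frechet_normal_cone ((n i * c) *\<^sub>R k) K"
      unfolding v_def using K(1) small by (rule frechet_normal_cone_local_cone)
    also have "\<dots> = frechet_normal_cone k K"
      using K(3) n c(1) by (intro frechet_normal_cone_scale) auto
    finally show ?thesis
      using l by simp
  qed
  then show ?thesis
    unfolding directional_normal_cone_def using t t_lim v_lim
    by (intro CollectI exI[of _ t] exI[of _ v] exI[of _ "\<lambda>_. l"]) auto
qed

section \<open>Multipliers of linear disjunctive programs\<close>

text \<open>Comparing squared distances bounds \<open>(y - k) \<bullet> v\<close> by half of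
  \<open>(norm v)\<^sup>2\<close>, a second-order quantity: projection residuals are proximal
  normals.\<close>

lemma nearest_point_frechet_normal:
  assumes k: "k \<in> K" and near: "\<And>k'. k' \<in> K \<Longrightarrow> norm (y - k) \<le> norm (y - k')" and "c \<ge> 0"
  shows "c *\<^sub>R (y - k) \<in> frechet_normal_cone k K"
  unfolding frechet_normal_cone_iff
proof (intro conjI allI impI)
  fix \<epsilon> :: real assume "\<epsilon> > 0"
  have "(c *\<^sub>R (y - k)) \<bullet> v \<le> \<epsilon> * norm v" if v: "norm v < \<epsilon> / (c + 1)" "k + v \<in> K" for v
  proof -
    have "(norm (y - k))\<^sup>2 \<le> (norm (y - k - v))\<^sup>2"
      using near[OF v(2)] by (simp add: algebra_simps)
    then have *: "2 * ((y - k) \<bullet> v) \<le> (norm v)\<^sup>2"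
      by (simp add: power2_norm_eq_inner algebra_simps inner_commute)
    have "(y - k) \<bullet> v \<le> norm v * norm v"
      using * zero_le_power2[of "norm v"] by (simp only: power2_eq_square)
    then have "c * ((y - k) \<bullet> v) \<le> c * (norm v * norm v)"
      using \<open>c \<ge> 0\<close> by (rule mult_left_mono)
    also have "\<dots> \<le> ((c + 1) * norm v) * norm v"
      by (simp add: algebra_simps)
    also have "\<dots> \<le> \<epsilon> * norm v"
      using v(1) \<open>c \<ge> 0\<close> by (intro mult_right_mono) (auto simp: field_simps)
    finally show ?thesis by simp
  qed
  moreover have "\<epsilon> / (c + 1) > 0"
    using \<open>\<epsilon> > 0\<close> \<open>c \<ge> 0\<close> by simp
  ultimately show "\<exists>\<delta>>0. \<forall>v. norm v < \<delta> \<and> k + v \<in> K \<longrightarrow> (c *\<^sub>R (y - k)) \<bullet> v \<le> \<epsilon> * norm v"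
    by blast
qed (rule k)

lemma coercive_attains_inf:
  fixes \<psi> :: "'a::euclidean_space \<Rightarrow> real"
  assumes cont: "continuous_on UNIV \<psi>" and far: "\<And>z. norm z > R \<Longrightarrow> \<psi> 0 \<le> \<psi> z"
  obtains x where "\<And>z. \<psi> x \<le> \<psi> z"
proof -
  have "\<exists>x\<in>cball 0 (max R 0). \<forall>z\<in>cball 0 (max R 0). \<psi> x \<le> \<psi> z"
    using cont by (intro continuous_attains_inf) (auto intro: continuous_on_subset)
  then obtain x where x: "\<And>z. z \<in> cball 0 (max R 0) \<Longrightarrow> \<psi> x \<le> \<psi> z"
    by blast
  have "\<psi> x \<le> \<psi> z" for z
  proof (cases "z \<in> cball 0 (max R 0)")
    case False
    then have "\<psi> 0 \<le> \<psi> z"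
      by (intro far) auto
    moreover have "\<psi> x \<le> \<psi> 0"
      by (rule x) auto
    ultimately show ?thesis by linarith
  qed (rule x)
  then show ?thesis
    using that by blast
qed

text \<open>The quadratic is minimal at 0, so its slope there vanishes; otherwise the value at
  \<open>- b / Q\<close>, with \<open>Q\<close> positive and above \<open>q\<close>, would be
  negative.\<close>

lemma linear_coeff_eq_0:
  fixes b q :: real
  assumes "\<And>t. 0 \<le> t * b + t\<^sup>2 * q"
  shows "b = 0"
proof (rule ccontr)
  assume "b \<noteq> 0"
  define Q where "Q = \<bar>q\<bar> + 1"
  have Q: "Q > 0" "q < Q"
    by (auto simp: Q_def)
  have "0 \<le> (- b / Q) * b + (- b / Q)\<^sup>2 * q"
    by (rule assms)
  also have "\<dots> = (b\<^sup>2 / Q\<^sup>2) * (q - Q)"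
    using Q by (simp add: field_simps power2_eq_square)
  also have "\<dots> < 0"
    using \<open>b \<noteq> 0\<close> Q by (intro mult_pos_neg) auto
  finally show False by simp
qed

text \<open>A quadratic penalty plus a small multiple of \<open>(norm z)\<^sup>2\<close> has a
  minimizer, whose scaled projection residual is the multiplier \<open>l\<close>. The bound with
  \<open>M\<close> keeps the penalized values bounded below, and \<open>orth\<close> lets
  stationarity express \<open>a \<bullet> z\<close> through \<open>l \<bullet> p\<close>.\<close>

lemma approximate_multiplier:
  fixes A :: "'a::euclidean_space \<Rightarrow> 'b::euclidean_space"
  assumes A: "linear A" and K: "closed K" "K \<noteq> {}"
    and orth: "\<And>k l. l \<in> frechet_normal_cone k K \<Longrightarrow> l \<bullet> k = 0"
    and bound: "\<And>z k. k \<in> K \<Longrightarrow> - M * norm (A z - k) \<le> a \<bullet> z" and "M \<ge> 0"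
    and feas: "\<And>\<delta>. \<delta> > 0 \<Longrightarrow> \<exists>z r. norm r < \<delta> \<and> A z + p - r \<in> K \<and> a \<bullet> z + s < \<delta>"
    and "\<eta> > 0"
  shows "\<exists>k\<in>K. \<exists>l\<in>frechet_normal_cone k K. norm (a + adjoint A l) \<le> \<eta> \<and> l \<bullet> p + s \<le> \<eta>"
proof -
  define \<phi> where "\<phi> c z k = a \<bullet> z + c * (norm (A z + p - k))\<^sup>2" for c :: real and z k
  define V where "V c = (INF (z,k)\<in>UNIV \<times> K. \<phi> c z k)" for c
  \<comment> \<open>From completing the square: \<open>n\<^sup>2 - M * n\<close> is at least
    \<open>- M\<^sup>2 / 4\<close>.\<close>
  define B where "B = - M * norm p - M\<^sup>2 / 4"
  have lb: "B \<le> \<phi> c z k" if "c \<ge> 1" "k \<in> K" for c z k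
  proof -
    define n where "n = norm (A z + p - k)"
    have "norm (A z - k) \<le> n + norm p"
      using norm_triangle_ineq4[of "A z + p - k" p] by (simp add: n_def algebra_simps)
    then have "M * norm (A z - k) \<le> M * (n + norm p)"
      using \<open>M \<ge> 0\<close> by (rule mult_left_mono)
    moreover have "n\<^sup>2 \<le> c * n\<^sup>2"
      using mult_right_mono[OF that(1), of "n\<^sup>2"] by simp
    moreover have "0 \<le> (n - M / 2)\<^sup>2"
      by simp
    moreover have "\<phi> c z k = a \<bullet> z + c * n\<^sup>2"
      by (simp add: \<phi>_def n_def)
    ultimately show ?thesis
      using bound[OF that(2), of z] by (simp add: B_def power2_eq_square algebra_simps)
  qed
  have bdd: "bdd_below ((\<lambda>(z, k). \<phi> c z k) ` (UNIV \<times> K))" if "c \<ge> 1" for c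
    using lb[OF that] by (intro bdd_belowI[of _ B]) auto
  have V_le: "V c \<le> \<phi> c z k" if "c \<ge> 1" "k \<in> K" for c z k
    using cINF_lower[OF bdd[OF that(1)], of "(z, k)"] that(2) by (simp add: V_def)
  have V_ge: "B \<le> V c" if "c \<ge> 1" for c
    unfolding V_def using K(2) lb[OF that] by (intro cINF_greatest) auto
  have V_near: "\<exists>z. \<exists>k\<in>K. \<phi> c z k < V c + \<epsilon>" if "c \<ge> 1" "\<epsilon> > 0" for c \<epsilon>
  proof -
    have "(INF (z,k)\<in>UNIV \<times> K. \<phi> c z k) < V c + \<epsilon>"
      using that(2) by (simp add: V_def)
    then show ?thesis
      using cINF_less_iff[OF _ bdd[OF that(1)]] K(2) by auto
  qed
  \<comment> \<open>Nearly feasible points suffice: for fixed \<open>c\<close> their penalty is at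
    most \<open>c * \<delta>\<close>, which vanishes with \<open>\<delta>\<close>.\<close>
  have V_s: "V c \<le> - s" if "c \<ge> 1" for c
  proof (rule field_le_epsilon)
    fix \<epsilon> :: real assume "\<epsilon> > 0"
    define \<delta> where "\<delta> = min 1 (\<epsilon> / (1 + c))"
    have \<delta>: "\<delta> > 0" "\<delta> \<le> 1" "\<delta> \<le> \<epsilon> / (1 + c)"
      using \<open>\<epsilon> > 0\<close> that by (auto simp: \<delta>_def)
    have \<delta>c: "\<delta> * (1 + c) \<le> \<epsilon>"
      using \<delta>(3) that by (simp add: pos_le_divide_eq)
    obtain z r where z: "norm r < \<delta>" "A z + p - r \<in> K" "a \<bullet> z + s < \<delta>"
      using feas[OF \<delta>(1)] by blast
    have "(norm r)\<^sup>2 \<le> \<delta>"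
      using mult_mono[of "norm r" \<delta> "norm r" 1] z(1) \<delta>(1,2) by (simp add: power2_eq_square)
    then have "c * (norm r)\<^sup>2 \<le> c * \<delta>"
      using that by (intro mult_left_mono) auto
    then show "V c \<le> - s + \<epsilon>"
      using V_le[OF that z(2), of z] z(3) \<delta>c by (simp add: \<phi>_def algebra_simps)
  qed
  \<comment> \<open>The first bound serves \<open>l \<bullet> p + s\<close>, the second the squared
    norm of the stationarity residual.\<close>
  define \<eta>' where "\<eta>' = min (\<eta> / 12) (\<eta>\<^sup>2 / 8)"
  have \<eta>': "\<eta>' > 0" "12 * \<eta>' \<le> \<eta>" "8 * \<eta>' \<le> \<eta>\<^sup>2"
    using \<open>\<eta> > 0\<close> by (auto simp: \<eta>'_def min_def)
  txt \<open>\<open>V\<close> is bounded and increasing, so it is nearly flat between some \<open>c\<close> and \<open>2 * c\<close>. Hence the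
    penalty term is small at near-minimizers, although the multipliers may be large.\<close>
  have "\<exists>c\<ge>1. V (2 * c) - V c \<le> \<eta>'"
  proof (rule ccontr)
    assume neg: "\<not> (\<exists>c\<ge>1. V (2 * c) - V c \<le> \<eta>')"
    have step: "V (2 * c) > V c + \<eta>'" if "c \<ge> 1" for c
    proof -
      have "\<not> V (2 * c) - V c \<le> \<eta>'"
        using neg that by blast
      then show ?thesis
        by simp
    qed
    have grow: "V (2 ^ n) \<ge> V 1 + real n * \<eta>'" for n
    proof (induction n)
      case (Suc n)
      then show ?case
        using step[of "2 ^ n"] by (simp add: algebra_simps)
    qed simp
    obtain n where "real n * \<eta>' > - s - B"
      using reals_Archimedean3[OF \<eta>'(1)] by blast
    moreover have "V (2 ^ n) \<le> - s"
      by (intro V_s one_le_power) simp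
    ultimately show False
      using V_ge[of 1] grow[of n] by simp
  qed
  then obtain c where c: "c \<ge> 1" "V (2 * c) - V c \<le> \<eta>'"
    by blast
  obtain z0 k0 where z0: "k0 \<in> K" "\<phi> (2 * c) z0 k0 < V (2 * c) + \<eta>'"
    using V_near[of "2 * c" \<eta>'] c(1) \<eta>'(1) by auto
  \<comment> \<open>Small enough that regularization costs at most \<open>\<eta>'\<close> at the
    near-minimizer \<open>z0\<close>, but positive, which makes \<open>\<psi>\<close>
    coercive.\<close>
  define \<epsilon> where "\<epsilon> = min 1 (\<eta>' / (1 + (norm z0)\<^sup>2))"
  have "1 + (norm z0)\<^sup>2 > 0"
    by (simp add: add_pos_nonneg)
  then have \<epsilon>: "\<epsilon> > 0" "\<epsilon> \<le> 1" "\<epsilon> * (1 + (norm z0)\<^sup>2) \<le> \<eta>'"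
    using \<eta>'(1) by (auto simp: \<epsilon>_def simp flip: pos_le_divide_eq)
  have \<epsilon>0: "\<epsilon> * (norm z0)\<^sup>2 \<le> \<eta>'"
    using \<epsilon> by (simp add: algebra_simps)
  define \<psi> where "\<psi> z = a \<bullet> z + (2 * c) * (infdist (A z + p) K)\<^sup>2 + \<epsilon> * (norm z)\<^sup>2" for z
  have \<psi>_le: "\<psi> z \<le> \<phi> (2 * c) z k + \<epsilon> * (norm z)\<^sup>2" if "k \<in> K" for z k
  proof -
    have "infdist (A z + p) K \<le> norm (A z + p - k)"
      using infdist_le[OF that] by (simp add: dist_norm)
    then have "(infdist (A z + p) K)\<^sup>2 \<le> (norm (A z + p - k))\<^sup>2"
      by (intro power_mono infdist_nonneg)
    then show ?thesis
      using c(1) by (simp add: \<psi>_def \<phi>_def)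
  qed
  have cont: "continuous_on UNIV \<psi>"
    unfolding \<psi>_def using linear_continuous_on[OF linear_conv_bounded_linear[THEN iffD1, OF A]]
    by (intro continuous_intros) 
  have far: "\<psi> 0 \<le> \<psi> z" if z: "norm z > (norm a + \<psi> 0) / \<epsilon> + 1" for z
  proof -
    have \<psi>0: "\<psi> 0 \<ge> 0"
      using c(1) by (simp add: \<psi>_def)
    have "norm z \<ge> 1"
      using z divide_nonneg_pos[OF add_nonneg_nonneg[OF norm_ge_zero \<psi>0] \<epsilon>(1), of a] by linarith
    have "(norm a + \<psi> 0) / \<epsilon> \<le> norm z"
      using z by simp
    then have "norm a + \<psi> 0 \<le> \<epsilon> * norm z"
      using \<epsilon>(1) by (simp add: field_simps)
    then have "norm z * (norm a + \<psi> 0) \<le> norm z * (\<epsilon> * norm z)"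
      by (intro mult_left_mono) auto
    moreover have "1 * \<psi> 0 \<le> norm z * \<psi> 0"
      using \<psi>0 \<open>norm z \<ge> 1\<close> by (rule mult_right_mono[rotated])
    moreover have "- (norm a * norm z) \<le> a \<bullet> z"
      using Cauchy_Schwarz_ineq2[of a z] by linarith
    moreover have "0 \<le> 2 * c * (infdist (A z + p) K)\<^sup>2"
      using c(1) by simp
    ultimately show ?thesis
      unfolding \<psi>_def[of z] by (simp add: power2_eq_square algebra_simps)
  qed
  obtain z where z: "\<And>y. \<psi> z \<le> \<psi> y"
    using coercive_attains_inf[OF cont far] by blast
  obtain k where k: "k \<in> K" "infdist (A z + p) K = dist (A z + p) k"
    using infdist_attains_inf[OF K] by blast
  define e where "e = A z + p - k"
  have \<psi>z: "\<psi> z = \<phi> (2 * c) z k + \<epsilon> * (norm z)\<^sup>2"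
    by (simp add: \<psi>_def \<phi>_def k(2) dist_norm)
  \<comment> \<open>The gradient, at \<open>A z + p\<close>, of \<open>2 * c\<close> times the
    squared distance to the fixed point \<open>k\<close>.\<close>
  define l where "l = (4 * c) *\<^sub>R e"
  have "norm e \<le> norm (A z + p - k')" if "k' \<in> K" for k'
    using infdist_le[OF that, of "A z + p"] k(2) by (simp add: dist_norm e_def)
  then have l: "l \<in> frechet_normal_cone k K"
    unfolding l_def e_def using c(1) k(1) by (intro nearest_point_frechet_normal) auto
  \<comment> \<open>Freezing \<open>k\<close> while \<open>z\<close> moves along \<open>d\<close>
    gives a quadratic in \<open>t\<close> that majorizes \<open>\<psi>\<close> and agrees with it at
    \<open>t = 0\<close>. Its linear coefficient must vanish, and the distance function never has to
    be differentiated.\<close>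
  have stat: "a \<bullet> d + l \<bullet> A d + 2 * \<epsilon> * (z \<bullet> d) = 0" for d
  proof (rule linear_coeff_eq_0)
    fix t :: real
    have le: "\<psi> z \<le> \<phi> (2 * c) (z + t *\<^sub>R d) k + \<epsilon> * (norm (z + t *\<^sub>R d))\<^sup>2"
      by (rule order_trans[OF z \<psi>_le[OF k(1)]])
    have "A (z + t *\<^sub>R d) + p - k = e + t *\<^sub>R A d"
      using A by (simp add: e_def linear_add linear_scale)
    then have "\<phi> (2 * c) (z + t *\<^sub>R d) k = a \<bullet> (z + t *\<^sub>R d) + 2 * c * (norm (e + t *\<^sub>R A d))\<^sup>2"
      by (simp add: \<phi>_def)
    moreover have "\<phi> (2 * c) z k = a \<bullet> z + 2 * c * (norm e)\<^sup>2"
      by (simp add: \<phi>_def e_def)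
    moreover have "(norm (e + t *\<^sub>R A d))\<^sup>2 = (norm e)\<^sup>2 + 2 * t * (e \<bullet> A d) + t\<^sup>2 * (norm (A d))\<^sup>2"
      "(norm (z + t *\<^sub>R d))\<^sup>2 = (norm z)\<^sup>2 + 2 * t * (z \<bullet> d) + t\<^sup>2 * (norm d)\<^sup>2"
      unfolding power2_norm_eq_inner inner_add_left inner_add_right inner_scaleR_left inner_scaleR_right
      by (simp_all add: power2_eq_square inner_commute algebra_simps)
    ultimately show "0 \<le> t * (a \<bullet> d + l \<bullet> A d + 2 * \<epsilon> * (z \<bullet> d))
        + t\<^sup>2 * (2 * c * (norm (A d))\<^sup>2 + \<epsilon> * (norm d)\<^sup>2)"
      using le by (simp add: \<psi>z l_def inner_add_right algebra_simps)
  qed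
  have small: "\<phi> (2 * c) z k + \<epsilon> * (norm z)\<^sup>2 \<le> V (2 * c) + 2 * \<eta>'"
    using z[of z0] \<psi>_le[OF z0(1), of z0] z0(2) \<epsilon>0 \<psi>z by linarith
  have \<epsilon>z: "\<epsilon> * (norm z)\<^sup>2 \<le> 2 * \<eta>'"
    using small V_le[of "2 * c" k z] c(1) k(1) by simp
  \<comment> \<open>Halving the penalty parameter frees \<open>c * (norm e)\<^sup>2\<close>; since
    \<open>V c\<close> bounds \<open>\<phi> c z k\<close> from below and is within
    \<open>\<eta>'\<close> of \<open>V (2 * c)\<close>, this penalty must be small.\<close>
  have "\<phi> (2 * c) z k = \<phi> c z k + c * (norm e)\<^sup>2"
    by (simp add: \<phi>_def e_def)
  moreover have "0 \<le> \<epsilon> * (norm z)\<^sup>2"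
    using \<epsilon>(1) by simp
  ultimately have pen: "c * (norm e)\<^sup>2 \<le> 3 * \<eta>'"
    using small V_le[OF c(1) k(1), of z] c(2) by linarith
  have "l \<bullet> A z = 4 * c * (norm e)\<^sup>2 - l \<bullet> p"
  proof -
    have "l \<bullet> A z = l \<bullet> (e - p + k)"
      by (simp add: e_def)
    also have "\<dots> = l \<bullet> e - l \<bullet> p"
      using orth[OF l] by (simp add: inner_add_right inner_diff_right)
    also have "l \<bullet> e = 4 * c * (norm e)\<^sup>2"
      by (simp add: l_def power2_norm_eq_inner)
    finally show ?thesis .
  qed
  \<comment> \<open>Stationarity is tested in the direction \<open>z\<close> itself.\<close>
  then have "a \<bullet> z = l \<bullet> p - 4 * c * (norm e)\<^sup>2 - 2 * \<epsilon> * (norm z)\<^sup>2"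
    using stat[of z] by (simp add: power2_norm_eq_inner)
  then have "l \<bullet> p + s \<le> 12 * \<eta>'"
    using small V_s[of "2 * c"] c(1) pen \<epsilon>z \<eta>'(1) by (simp add: \<phi>_def e_def[symmetric])
  moreover have "norm (a + adjoint A l) \<le> \<eta>"
  proof -
    have "(a + adjoint A l + (2 * \<epsilon>) *\<^sub>R z) \<bullet> d = 0" for d
      using stat[of d] adjoint_clauses(2)[OF A, of l d] by (simp add: inner_add_left)
    then have "a + adjoint A l + (2 * \<epsilon>) *\<^sub>R z = 0"
      by (rule inner_eq_zero_iff[THEN iffD1])
    then have "a + adjoint A l = - ((2 * \<epsilon>) *\<^sub>R z)"
      by (simp add: eq_neg_iff_add_eq_0)
    \<comment> \<open>Only \<open>\<epsilon> * (norm z)\<^sup>2\<close> is under control; the other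
      factor \<open>\<epsilon>\<close> is at most 1.\<close>
    then have "(norm (a + adjoint A l))\<^sup>2 = 4 * \<epsilon> * (\<epsilon> * (norm z)\<^sup>2)"
      using \<epsilon>(1) by (simp add: power2_eq_square)
    also have "\<dots> \<le> 4 * (2 * \<eta>')"
      using mult_mono[OF \<epsilon>(2) \<epsilon>z] \<epsilon>(1) by simp
    also have "\<dots> \<le> \<eta>\<^sup>2"
      using \<eta>'(3) by simp
    finally show ?thesis
      by (rule power2_le_imp_le) (use \<open>\<eta> > 0\<close> in simp)
  qed
  ultimately show ?thesis
    using k(1) l \<eta>'(2) by (intro bexI[of _ k] bexI[of _ l]) auto
qed

text \<open>Farkas multipliers of the single cones give the bound that the penalty argument needs.
  The resulting approximate multipliers may be unbounded, but infinitely many lie in one polyhedral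
  normal cone, where \<open>polyhedral_cone_limit\<close> produces an exact one.\<close>

lemma disjunctive_multiplier:
  fixes A :: "'a::euclidean_space \<Rightarrow> 'b::euclidean_space" and \<K> :: "'b set set"
  assumes A: "linear A"
    and \<K>: "finite \<K>" "\<And>P. P \<in> \<K> \<Longrightarrow> polyhedron P" "\<And>P. P \<in> \<K> \<Longrightarrow> convex_cone P"
    and nonneg: "\<And>z. A z \<in> \<Union>\<K> \<Longrightarrow> a \<bullet> z \<ge> 0"
    and feas: "\<And>\<delta>. \<delta> > 0 \<Longrightarrow> \<exists>z r. norm r < \<delta> \<and> A z + p - r \<in> \<Union>\<K> \<and> a \<bullet> z + s < \<delta>"
  shows "\<exists>k\<in>\<Union>\<K>. \<exists>l\<in>frechet_normal_cone k (\<Union>\<K>). (\<forall>z. a \<bullet> z + l \<bullet> A z = 0) \<and> l \<bullet> p + s \<le> 0"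
proof -
  define K where "K = \<Union>\<K>"
  have K: "closed K" "K \<noteq> {}"
    using \<K> polyhedron_imp_closed feas[of 1] by (auto simp: K_def)
  have "\<exists>l\<in>polar_cone P. \<forall>z. a \<bullet> z + l \<bullet> A z = 0" if "P \<in> \<K>" for P
    using polyhedral_farkas[OF A \<K>(2,3)[OF that], of a] nonneg that by blast
  then obtain m where m: "\<And>P. P \<in> \<K> \<Longrightarrow> m P \<in> polar_cone P" "\<And>P z. P \<in> \<K> \<Longrightarrow> a \<bullet> z + m P \<bullet> A z = 0"
    by metis
  \<comment> \<open>The sum is a single constant dominating every \<open>norm (m P)\<close>.\<close>
  define M where "M = (\<Sum>P\<in>\<K>. norm (m P))"
  have "M \<ge> 0"
    by (simp add: M_def sum_nonneg)
  have bound: "- M * norm (A z - k) \<le> a \<bullet> z" if "k \<in> K" for z k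
  proof -
    obtain P where P: "P \<in> \<K>" "k \<in> P"
      using \<open>k \<in> K\<close> by (auto simp: K_def)
    have "norm (m P) \<le> M"
      unfolding M_def using \<K>(1) P(1) by (intro member_le_sum) auto
    then have "norm (m P) * norm (A z - k) \<le> M * norm (A z - k)"
      by (intro mult_right_mono) auto
    moreover have "m P \<bullet> (A z - k) \<le> norm (m P) * norm (A z - k)"
      by (rule norm_cauchy_schwarz)
    moreover have "m P \<bullet> k \<le> 0"
      using m(1)[OF P(1)] P(2) by (simp add: polar_cone_def)
    moreover have "a \<bullet> z = - (m P \<bullet> (A z - k)) - m P \<bullet> k"
      using m(2)[OF P(1), of z] by (simp add: inner_diff_right)
    ultimately show ?thesis
      by simp
  qed
  have orth: "l \<bullet> k = 0" if "l \<in> frechet_normal_cone k K" for l k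
    using that \<K> polyhedron_imp_closed unfolding K_def by (intro frechet_normal_orthogonal[of \<K>]) auto
  have "\<exists>k\<in>K. \<exists>l\<in>frechet_normal_cone k K. norm (a + adjoint A l) \<le> \<eta> \<and> l \<bullet> p + s \<le> \<eta>" if "\<eta> > 0" for \<eta>
    using A K orth bound \<open>M \<ge> 0\<close> feas[folded K_def] that by (rule approximate_multiplier)
  then have "\<forall>n. \<exists>k\<in>K. \<exists>l\<in>frechet_normal_cone k K.
      norm (a + adjoint A l) \<le> inverse (real (Suc n)) \<and> l \<bullet> p + s \<le> inverse (real (Suc n))"
    by simp
  then obtain k l where kl: "\<And>n. k n \<in> K" "\<And>n. l n \<in> frechet_normal_cone (k n) K"
      "\<And>n. norm (a + adjoint A (l n)) \<le> inverse (real (Suc n))"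
      "\<And>n. l n \<bullet> p + s \<le> inverse (real (Suc n))"
    by metis
  have "finite ((\<lambda>n. frechet_normal_cone (k n) K) ` UNIV)"
  proof (rule finite_subset)
    show "finite ((\<lambda>k. frechet_normal_cone k K) ` K)"
      unfolding K_def using \<K> by (intro finite_frechet_normal_cones) auto
  qed (use kl(1) in auto)
  then obtain n0 where "infinite {n \<in> UNIV. frechet_normal_cone (k n) K = frechet_normal_cone (k n0) K}"
    using pigeonhole_infinite[of "UNIV :: nat set"] by blast
  then have inf: "infinite {n. frechet_normal_cone (k n) K = frechet_normal_cone (k n0) K}"
    by simp
  \<comment> \<open>The pigeonhole class becomes a subsequence: the base points
    \<open>k (j i)\<close> may vary, but their normal cone does not.\<close>
  define j where "j = enumerate {n. frechet_normal_cone (k n) K = frechet_normal_cone (k n0) K}"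
  have j: "strict_mono j" "\<And>i. frechet_normal_cone (k (j i)) K = frechet_normal_cone (k n0) K"
    using inf enumerate_in_set[OF inf] by (auto simp: j_def strict_mono_enumerate)
  define N where "N = frechet_normal_cone (k n0) K"
  have N: "polyhedron N" "convex_cone N"
    using \<K> kl(1)[of n0] unfolding N_def K_def by (auto intro!: polyhedral_frechet_normal_cone)
  have lim: "(\<lambda>i. inverse (real (Suc (j i)))) \<longlonglongrightarrow> 0"
    using LIMSEQ_subseq_LIMSEQ[OF LIMSEQ_inverse_real_of_nat j(1)] by (simp add: o_def)
  have "(\<lambda>i. a + adjoint A (l (j i))) \<longlonglongrightarrow> 0"
    using kl(3) by (intro Lim_null_comparison[OF _ lim]) auto
  then have "(\<lambda>i. (a + adjoint A (l (j i))) - a) \<longlonglongrightarrow> 0 - a"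
    by (intro tendsto_diff tendsto_const)
  then have adj: "(\<lambda>i. adjoint A (l (j i))) \<longlonglongrightarrow> - a"
    by simp
  have "\<exists>l0\<in>N. adjoint A l0 = - a \<and> l0 \<bullet> p \<le> 0 - s"
  proof (rule polyhedral_cone_limit[OF N adjoint_linear[OF A]])
    show "linear (\<lambda>l. l \<bullet> p)"
      by (simp add: linear_iff inner_add_left)
    show "l (j i) \<in> N" for i
      using kl(2)[of "j i"] j(2)[of i] by (simp add: N_def)
    show "l (j i) \<bullet> p \<le> inverse (real (Suc (j i))) - s" for i
      using kl(4)[of "j i"] by simp
    show "(\<lambda>i. inverse (real (Suc (j i))) - s) \<longlonglongrightarrow> 0 - s"
      using lim by (intro tendsto_diff tendsto_const)
  qed (rule adj)
  then obtain l0 where l0: "l0 \<in> N" "adjoint A l0 = - a" "l0 \<bullet> p \<le> 0 - s"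
    by blast
  have "a \<bullet> z + l0 \<bullet> A z = 0" for z
    using adjoint_clauses(2)[OF A, of l0 z] l0(2) by simp
  then show ?thesis
    using l0 kl(1)[of n0] unfolding N_def K_def by (intro bexI[of _ "k n0"] bexI[of _ l0]) auto
qed

section \<open>Second-order expansions\<close>

text \<open>The mean value inequality is applied to the remainder on the segment from
  \<open>x\<close> to \<open>x + h\<close>. Its derivative there is the first-order error of
  \<open>g'\<close> at \<open>x\<close>, so differentiability of \<open>g'\<close> at this one point
  is enough.\<close>

lemma second_order_taylor:
  fixes g :: "'a::real_normed_vector \<Rightarrow> 'b::real_normed_vector" and g' :: "'a \<Rightarrow> 'a \<Rightarrow>\<^sub>L 'b"
  assumes ev: "\<forall>\<^sub>F y in nhds x. (g has_derivative blinfun_apply (g' y)) (at y)"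
    and D: "(g' has_derivative D) (at x)" and "e > 0"
  shows "\<forall>\<^sub>F h in nhds 0. norm (g (x + h) - g x - g' x h - (1/2) *\<^sub>R D h h) \<le> e * (norm h)\<^sup>2"
proof -
  obtain d1 where d1: "d1 > 0" "\<And>y. dist y x < d1 \<Longrightarrow> (g has_derivative blinfun_apply (g' y)) (at y)"
    using ev unfolding eventually_nhds_metric by blast
  obtain d2 where d2: "d2 > 0"
      "\<And>y. norm (y - x) < d2 \<Longrightarrow> norm (g' y - g' x - D (y - x)) \<le> e * norm (y - x)"
    using D \<open>e > 0\<close> unfolding has_derivative_at_alt by blast
  have linD: "linear D"
    using D by (rule has_derivative_linear)
  have "norm (g (x + h) - g x - g' x h - (1/2) *\<^sub>R D h h) \<le> e * (norm h)\<^sup>2"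
    if h: "norm h < min d1 d2" for h
  proof -
    define \<phi> where "\<phi> t = g (x + t *\<^sub>R h) - t *\<^sub>R g' x h - (t\<^sup>2 / 2) *\<^sub>R D h h" for t
    define \<phi>' where "\<phi>' t = (g' (x + t *\<^sub>R h) - g' x - D (t *\<^sub>R h)) h" for t
    have th: "norm (t *\<^sub>R h) \<le> norm h" if "t \<in> {0..1}" for t
      using that mult_right_mono[of t 1 "norm h"] by simp
    have der: "(\<phi> has_derivative (\<lambda>s. s *\<^sub>R \<phi>' t)) (at t within {0..1})" if t: "t \<in> {0..1}" for t
    proof -
      have "dist (x + t *\<^sub>R h) x < d1"
        using th[OF t] h by (simp add: dist_norm)
      then have "(g has_derivative blinfun_apply (g' (x + t *\<^sub>R h))) (at (x + t *\<^sub>R h))"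
        by (rule d1(2))
      then have "((\<lambda>t. g (x + t *\<^sub>R h)) has_derivative (\<lambda>s. g' (x + t *\<^sub>R h) (s *\<^sub>R h))) (at t within {0..1})"
        by (rule has_derivative_compose[rotated]) (auto intro!: derivative_eq_intros)
      then show ?thesis
        unfolding \<phi>_def \<phi>'_def
        by (auto intro!: derivative_eq_intros simp: blinfun.bilinear_simps linear_scale[OF linD] algebra_simps)
    qed
    have bound: "onorm (\<lambda>s. s *\<^sub>R \<phi>' t) \<le> e * (norm h)\<^sup>2" if t: "t \<in> {0..1}" for t
    proof (rule onorm_bound)
      have "norm (\<phi>' t) \<le> norm (g' (x + t *\<^sub>R h) - g' x - D (t *\<^sub>R h)) * norm h"
        unfolding \<phi>'_def by (rule norm_blinfun)
      also have "\<dots> \<le> (e * norm (t *\<^sub>R h)) * norm h"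
        using d2(2)[of "x + t *\<^sub>R h"] th[OF t] h by (intro mult_right_mono) auto
      also have "\<dots> \<le> (e * norm h) * norm h"
        using th[OF t] \<open>e > 0\<close> by (intro mult_right_mono mult_left_mono) auto
      finally have "norm (\<phi>' t) \<le> e * (norm h)\<^sup>2"
        by (simp add: power2_eq_square)
      then show "norm (s *\<^sub>R \<phi>' t) \<le> e * (norm h)\<^sup>2 * norm s" for s :: real
        using mult_left_mono[of "norm (\<phi>' t)" "e * (norm h)\<^sup>2" "\<bar>s\<bar>"] by (simp add: mult.commute)
    qed (use \<open>e > 0\<close> in simp)
    have "norm (\<phi> 1 - \<phi> 0) \<le> e * (norm h)\<^sup>2 * norm (1 - 0 :: real)"
      by (rule differentiable_bound[OF _ der bound]) auto
    then show ?thesis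
      by (simp add: \<phi>_def algebra_simps)
  qed
  then show ?thesis
    unfolding eventually_nhds_metric using d1(1) d2(1) by (intro exI[of _ "min d1 d2"]) (auto simp: dist_norm)
qed

text \<open>The first-order term is taken along \<open>v k\<close> and not along the limit
  \<open>u\<close>, because \<open>(v k - u) / t k\<close> need not be bounded.\<close>

lemma second_order_quotient_tendsto:
  fixes g :: "'a::real_normed_vector \<Rightarrow> 'b::real_normed_vector" and g' :: "'a \<Rightarrow> 'a \<Rightarrow>\<^sub>L 'b"
  assumes ev: "\<forall>\<^sub>F y in nhds x. (g has_derivative blinfun_apply (g' y)) (at y)"
    and D: "(g' has_derivative D) (at x)"
    and t: "\<And>k. t k > 0" "t \<longlonglongrightarrow> 0" and v: "\<And>k. norm (v k) = 1" "v \<longlonglongrightarrow> u"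
  shows "(\<lambda>k. (1 / (t k)\<^sup>2) *\<^sub>R (g (x + t k *\<^sub>R v k) - g x - t k *\<^sub>R g' x (v k))) \<longlonglongrightarrow> (1/2) *\<^sub>R D u u"
proof -
  have linD: "linear D"
    using D by (rule has_derivative_linear)
  define R where "R k = (1 / (t k)\<^sup>2) *\<^sub>R (g (x + t k *\<^sub>R v k) - g x - t k *\<^sub>R g' x (v k)) - (1/2) *\<^sub>R D (v k) (v k)" for k
  have tv: "(\<lambda>k. t k *\<^sub>R v k) \<longlonglongrightarrow> 0"
    using tendsto_scaleR[OF t(2) v(2)] by simp
  have "R \<longlonglongrightarrow> 0"
  proof (rule tendstoI)
    fix e :: real assume "e > 0"
    have "\<forall>\<^sub>F h in nhds 0. norm (g (x + h) - g x - g' x h - (1/2) *\<^sub>R D h h) \<le> e / 2 * (norm h)\<^sup>2"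
      using ev D \<open>e > 0\<close> by (intro second_order_taylor) auto
    then have "\<forall>\<^sub>F k in sequentially. norm (g (x + t k *\<^sub>R v k) - g x - g' x (t k *\<^sub>R v k)
        - (1/2) *\<^sub>R D (t k *\<^sub>R v k) (t k *\<^sub>R v k)) \<le> e / 2 * (norm (t k *\<^sub>R v k))\<^sup>2"
      using tv by (rule eventually_compose_filterlim)
    then show "\<forall>\<^sub>F k in sequentially. dist (R k) 0 < e"
    proof eventually_elim
      case (elim k)
      have "g (x + t k *\<^sub>R v k) - g x - g' x (t k *\<^sub>R v k) - (1/2) *\<^sub>R D (t k *\<^sub>R v k) (t k *\<^sub>R v k)
          = (t k)\<^sup>2 *\<^sub>R R k"
        using t(1)[of k] by (simp add: R_def blinfun.bilinear_simps linear_scale[OF linD] scaleR_right_diff_distrib power2_eq_square)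
      then have "(t k)\<^sup>2 * norm (R k) \<le> (t k)\<^sup>2 * (e / 2)"
        using elim v(1)[of k] by (simp add: mult.commute)
      then have "norm (R k) \<le> e / 2"
        using t(1)[of k] by simp
      then show ?case
        using \<open>e > 0\<close> by simp
    qed
  qed
  moreover have "(\<lambda>k. (1/2) *\<^sub>R D (v k) (v k)) \<longlonglongrightarrow> (1/2) *\<^sub>R D u u"
    using bounded_linear.tendsto[OF has_derivative_bounded_linear[OF D] v(2)] v(2)
    by (intro tendsto_intros blinfun.tendsto)
  ultimately have "(\<lambda>k. R k + (1/2) *\<^sub>R D (v k) (v k)) \<longlonglongrightarrow> 0 + (1/2) *\<^sub>R D u u"
    by (rule tendsto_add)
  then show ?thesis
    by (simp add: R_def)
qed

section \<open>Gradients, Jacobians and Hessians in coordinates\<close>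

lemma linear_vec_expansion:
  fixes h :: "real ^ 'n \<Rightarrow> 'b::real_vector"
  assumes "linear h"
  shows "h d = (\<Sum>i\<in>UNIV. d $ i *\<^sub>R h (axis i 1))"
proof -
  have "h d = h (\<Sum>i\<in>UNIV. d $ i *\<^sub>R axis i 1)"
    using basis_expansion[of d] by (simp add: scalar_mult_eq_scaleR)
  then show ?thesis
    by (simp add: linear_sum[OF assms] linear_scale[OF assms])
qed

lemma grad_eq:
  assumes "(g has_derivative g') (at y)"
  shows "grad g y = (\<chi> i. g' (axis i 1))"
  using frechet_derivative_at[OF assms] by (simp add: grad_def)

lemma grad_inner:
  fixes g :: "real ^ 'n \<Rightarrow> real"
  assumes "(g has_derivative g') (at y)"
  shows "grad g y \<bullet> d = g' d"
  using linear_vec_expansion[OF has_derivative_linear[OF assms], of d]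
  by (simp add: grad_eq[OF assms] inner_vec_def mult.commute)

lemma jacobian_mult:
  fixes F :: "real ^ 'n \<Rightarrow> real ^ 'm"
  assumes "(F has_derivative F') (at y)"
  shows "jacobian F (at y) *v d = F' d"
proof -
  have "(F has_derivative (\<lambda>h. jacobian F (at y) *v h)) (at y)"
    using assms jacobian_works differentiable_def by blast
  then show ?thesis
    using has_derivative_unique[OF assms] by metis
qed

lemma hessian_inner:
  fixes g :: "real ^ 'n \<Rightarrow> real" and g' :: "real ^ 'n \<Rightarrow> (real ^ 'n) \<Rightarrow>\<^sub>L real"
  assumes ev: "\<forall>\<^sub>F y in nhds x. (g has_derivative blinfun_apply (g' y)) (at y)"
    and D: "(g' has_derivative D) (at x)"
  shows "u \<bullet> (hessian g x *v v) = D v u"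
proof -
  \<comment> \<open>As a sum of basis vectors, the coordinate vector is visibly linear in
    \<open>B\<close>, so the derivative rules apply.\<close>
  have eq: "(\<chi> i. B (axis i 1)) = (\<Sum>i\<in>UNIV. blinfun_apply B (axis i 1) *\<^sub>R axis i (1::real))"
    for B :: "(real ^ 'n) \<Rightarrow>\<^sub>L real"
    using basis_expansion[of "\<chi> i. B (axis i 1)"] by (simp add: scalar_mult_eq_scaleR)
  have der: "((\<lambda>y. \<chi> i. g' y (axis i 1)) has_derivative (\<lambda>h. \<chi> i. D h (axis i 1))) (at x)"
    unfolding eq
    by (intro has_derivative_sum has_derivative_scaleR_left
        bounded_linear.has_derivative[OF blinfun.bounded_linear_left] D)
  have eq': "\<forall>\<^sub>F y in nhds x. grad g y = (\<chi> i. g' y (axis i 1))"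
    using ev by eventually_elim (rule grad_eq)
  have "(grad g has_derivative (\<lambda>h. \<chi> i. D h (axis i 1))) (at x)"
  proof (rule has_derivative_transform_eventually[OF der])
    show "\<forall>\<^sub>F y in at x. (\<chi> i. g' y (axis i 1)) = grad g y"
      using eq' by (auto simp: eventually_at_filter elim: eventually_mono)
    show "(\<chi> i. g' x (axis i 1)) = grad g x"
      using eventually_nhds_x_imp_x[OF eq'] by simp
  qed simp
  then have "hessian g x *v v = (\<chi> i. D v (axis i 1))"
    unfolding hessian_def by (rule jacobian_mult)
  then show ?thesis
    using linear_vec_expansion[OF blinfun.bounded_linear_right[THEN bounded_linear.linear], of "D v" u]
    by (simp add: inner_vec_def)
qed

lemma lagrangian_grad_inner:
  assumes "(f has_derivative f') (at x)" "(F has_derivative F') (at x)"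
  shows "grad (\<lambda>y. lagrangian f F y 1 l) x \<bullet> d = f' d + l \<bullet> F' d"
  unfolding lagrangian_def by (intro grad_inner) (auto intro!: derivative_eq_intros assms)

lemma lagrangian_hessian_inner:
  fixes f :: "real ^ 'n \<Rightarrow> real" and F :: "real ^ 'n \<Rightarrow> real ^ 'm"
  assumes f: "\<forall>\<^sub>F y in nhds x. (f has_derivative blinfun_apply (f' y)) (at y)" "(f' has_derivative Df) (at x)"
    and F: "\<forall>\<^sub>F y in nhds x. (F has_derivative blinfun_apply (F' y)) (at y)" "(F' has_derivative DF) (at x)"
  shows "u \<bullet> (hessian (\<lambda>y. lagrangian f F y 1 l) x *v u) = Df u u + l \<bullet> DF u u"
proof -
  define L' where "L' y = f' y + (blinfun_inner_right l o\<^sub>L F' y)" for y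
  define D where "D h = Df h + (blinfun_inner_right l o\<^sub>L DF h)" for h
  have "\<forall>\<^sub>F y in nhds x. ((\<lambda>y. lagrangian f F y 1 l) has_derivative blinfun_apply (L' y)) (at y)"
    using f(1) F(1)
  proof eventually_elim
    case (elim y)
    then show ?case
      unfolding lagrangian_def L'_def
      by (auto intro!: derivative_eq_intros simp: blinfun.bilinear_simps)
  qed
  moreover have "(L' has_derivative D) (at x)"
    unfolding L'_def D_def
    by (intro has_derivative_add f(2) bounded_linear.has_derivative[OF _ F(2)]
        bounded_bilinear.bounded_linear_right[OF bounded_bilinear_blinfun_compose])
  ultimately have "u \<bullet> (hessian (\<lambda>y. lagrangian f F y 1 l) x *v u) = D u u"
    by (rule hessian_inner)
  then show ?thesis
    by (simp add: D_def blinfun.bilinear_simps)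
qed

section \<open>The second-order sufficient condition\<close>

text \<open>The growth condition is refuted on the ball of radius \<open>e k\<close> with constant
  \<open>e k\<close>; compactness of the unit sphere gives the limit direction, and
  \<open>y k\<close> is a projection onto the closed set \<open>\<Omega>\<close>.\<close>

lemma not_essential_minimizer_sequence:
  fixes f :: "real ^ 'n \<Rightarrow> real" and F :: "real ^ 'n \<Rightarrow> real ^ 'm"
  assumes \<Omega>: "closed \<Omega>" "F x \<in> \<Omega>" and neg: "\<not> essential_local_minimizer_second_order f F \<Omega> x"
  obtains \<epsilon> t :: "nat \<Rightarrow> real" and v u y where
    "\<And>k. t k > 0" "t \<longlonglongrightarrow> 0" "\<And>k. norm (v k) = 1" "v \<longlonglongrightarrow> u" "\<epsilon> \<longlonglongrightarrow> 0" "\<And>k. y k \<in> \<Omega>"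
    "\<And>k. f (x + t k *\<^sub>R v k) - f x \<le> \<epsilon> k * (t k)\<^sup>2"
    "\<And>k. norm (y k - F (x + t k *\<^sub>R v k)) \<le> \<epsilon> k * (t k)\<^sup>2"
proof -
  define e where "e k = inverse (real (Suc k))" for k
  have e: "e k > 0" for k
    by (simp add: e_def)
  have e_lim: "e \<longlonglongrightarrow> 0"
    unfolding e_def by (rule LIMSEQ_inverse_real_of_nat)
  have "\<exists>X. X \<in> ball x (e k) \<and> max (f X - f x) (infdist (F X) \<Omega>) < e k * (norm (X - x))\<^sup>2" for k
  proof (rule ccontr)
    assume "\<nexists>X. X \<in> ball x (e k) \<and> max (f X - f x) (infdist (F X) \<Omega>) < e k * (norm (X - x))\<^sup>2"
    then have "\<forall>X\<in>ball x (e k). max (f X - f x) (infdist (F X) \<Omega>) \<ge> e k * (norm (X - x))\<^sup>2"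
      using not_le by blast
    moreover have "open (ball x (e k))" "x \<in> ball x (e k)"
      using e by auto
    ultimately show False
      using neg \<Omega>(2) e[of k] unfolding essential_local_minimizer_second_order_def by blast
  qed
  then obtain X where X: "\<And>k. X k \<in> ball x (e k)"
      "\<And>k. max (f (X k) - f x) (infdist (F (X k)) \<Omega>) < e k * (norm (X k - x))\<^sup>2"
    by metis
  \<comment> \<open>At \<open>x\<close> itself both sides of the strict inequality are 0.\<close>
  have ne: "X k \<noteq> x" for k
    using X(2)[of k] \<Omega>(2) by auto
  define T where "T k = norm (X k - x)" for k
  define V where "V k = (1 / T k) *\<^sub>R (X k - x)" for k
  have T: "T k > 0" for k
    using ne by (simp add: T_def)
  have XTV: "X k = x + T k *\<^sub>R V k" for k
    using T[of k] by (simp add: V_def)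
  have nV: "norm (V k) = 1" for k
    using T[of k] by (simp add: V_def T_def)
  have "seq_compact (sphere (0 :: real ^ 'n) 1)" "\<forall>k. V k \<in> sphere 0 1"
    using nV by (auto simp: compact_imp_seq_compact)
  then obtain u j where j: "strict_mono j" "(V \<circ> j) \<longlonglongrightarrow> u"
    by (rule seq_compactE)
  have "T k \<le> e k" for k
    using X(1)[of k] by (simp add: T_def dist_norm norm_minus_commute less_imp_le)
  then have "T \<longlonglongrightarrow> 0"
    using T by (intro tendsto_sandwich[OF _ _ tendsto_const e_lim]) (auto simp: less_imp_le)
  then have T_lim: "(T \<circ> j) \<longlonglongrightarrow> 0"
    using j(1) by (rule LIMSEQ_subseq_LIMSEQ)
  have ej_lim: "(e \<circ> j) \<longlonglongrightarrow> 0"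
    using e_lim j(1) by (rule LIMSEQ_subseq_LIMSEQ)
  have "\<exists>y\<in>\<Omega>. infdist (F (X k)) \<Omega> = dist (F (X k)) y" for k
    using infdist_attains_inf[of \<Omega>] \<Omega> by blast
  then obtain y where y: "\<And>k. y k \<in> \<Omega>" "\<And>k. infdist (F (X k)) \<Omega> = dist (F (X k)) (y k)"
    by metis
  have Xj: "x + (T \<circ> j) k *\<^sub>R (V \<circ> j) k = X (j k)" for k
    by (simp flip: XTV)
  show ?thesis
  proof (rule that[of "T \<circ> j" "V \<circ> j" u "e \<circ> j" "y \<circ> j"])
    show "f (x + (T \<circ> j) k *\<^sub>R (V \<circ> j) k) - f x \<le> (e \<circ> j) k * ((T \<circ> j) k)\<^sup>2" for k
      using X(2)[of "j k"] unfolding Xj by (simp add: T_def)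
    show "norm ((y \<circ> j) k - F (x + (T \<circ> j) k *\<^sub>R (V \<circ> j) k)) \<le> (e \<circ> j) k * ((T \<circ> j) k)\<^sup>2" for k
      using X(2)[of "j k"] y(2)[of "j k"] unfolding Xj by (simp add: T_def dist_norm norm_minus_commute)
  qed (use T T_lim nV j ej_lim y in auto)
qed

theorem theorem3p21:
  fixes f :: "real ^ 'n \<Rightarrow> real"
    and F :: "real ^ 'n \<Rightarrow> real ^ 'm"
    and \<Omega> :: "(real ^ 'm) set"
    and xbar :: "real ^ 'n"
  assumes "continuously_differentiable f"
    and "continuously_differentiable F"
    and "finite_union_of_polyhedra \<Omega>"
    and "extended_M_stationary f F \<Omega> xbar"
    and "twice_frechet_differentiable_at f xbar"
    and "twice_frechet_differentiable_at F xbar"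
    and "\<And>u l. u \<in> critical_cone f F \<Omega> xbar \<Longrightarrow> u \<noteq> 0 \<Longrightarrow> l \<in> multipliers f F \<Omega> xbar u \<Longrightarrow>
           u \<bullet> (hessian (\<lambda>x. lagrangian f F x 1 l) xbar *v u) > 0"
  shows "essential_local_minimizer_second_order f F \<Omega> xbar"
proof (rule ccontr)
  assume neg: "\<not> essential_local_minimizer_second_order f F \<Omega> xbar"
  obtain f' Df where f: "\<forall>\<^sub>F y in nhds xbar. (f has_derivative blinfun_apply (f' y)) (at y)"
      "(f' has_derivative Df) (at xbar)"
    using assms(5) unfolding twice_frechet_differentiable_at_def differentiable_def by blast
  obtain F' DF where F: "\<forall>\<^sub>F y in nhds xbar. (F has_derivative blinfun_apply (F' y)) (at y)"
      "(F' has_derivative DF) (at xbar)"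
    using assms(6) unfolding twice_frechet_differentiable_at_def differentiable_def by blast
  note f_der = eventually_nhds_x_imp_x[OF f(1)] and F_der = eventually_nhds_x_imp_x[OF F(1)]
  define a where "a = grad f xbar"
  have a: "a \<bullet> d = f' xbar d" for d
    unfolding a_def using f_der by (rule grad_inner)
  define A where "A = blinfun_apply (F' xbar)"
  have jac: "jacobian F (at xbar) *v d = A d" for d
    unfolding A_def using F_der by (rule jacobian_mult)
  have A: "linear A"
    unfolding A_def by (rule bounded_linear.linear[OF blinfun.bounded_linear_right])
  have grad_L: "grad (\<lambda>y. lagrangian f F y 1 l) xbar \<bullet> d = a \<bullet> d + l \<bullet> A d" for l d
    unfolding a A_def using f_der F_der by (rule lagrangian_grad_inner)
  have feasible: "F xbar \<in> \<Omega>"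
    using assms(4) by (simp add: extended_M_stationary_def)
  have "closed \<Omega>"
    using assms(3) polyhedron_imp_closed by (auto simp: finite_union_of_polyhedra_def)
  then obtain \<epsilon> t :: "nat \<Rightarrow> real" and v u y where t: "\<And>k. t k > 0" "t \<longlonglongrightarrow> 0"
    and v: "\<And>k. norm (v k) = 1" "v \<longlonglongrightarrow> u" and \<epsilon>: "\<epsilon> \<longlonglongrightarrow> 0" and y: "\<And>k. y k \<in> \<Omega>"
    and f_le: "\<And>k. f (xbar + t k *\<^sub>R v k) - f xbar \<le> \<epsilon> k * (t k)\<^sup>2"
    and F_near: "\<And>k. norm (y k - F (xbar + t k *\<^sub>R v k)) \<le> \<epsilon> k * (t k)\<^sup>2"
    using not_essential_minimizer_sequence[OF _ feasible neg] by metis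
  have "u \<noteq> 0"
    using tendsto_norm[OF v(2)] v(1) by (auto simp: LIMSEQ_const_iff)

  define s where "s = (1/2) * Df u u"
  define S where "S k = (1 / (t k)\<^sup>2) * (f (xbar + t k *\<^sub>R v k) - f xbar - t k * (a \<bullet> v k))" for k
  have S: "S \<longlonglongrightarrow> s"
    using second_order_quotient_tendsto[OF f t v] by (simp add: S_def[abs_def] s_def a)
  define p where "p = (1/2) *\<^sub>R DF u u"
  define P where "P k = (1 / (t k)\<^sup>2) *\<^sub>R (F (xbar + t k *\<^sub>R v k) - F xbar - t k *\<^sub>R A (v k))" for k
  have P: "P \<longlonglongrightarrow> p"
    using second_order_quotient_tendsto[OF F t v] by (simp add: P_def[abs_def] p_def A_def)
  define q where "q k = (1 / (t k)\<^sup>2) *\<^sub>R (y k - F (xbar + t k *\<^sub>R v k))" for k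
  have "norm (q k) \<le> \<epsilon> k" for k
    using F_near[of k] t(1)[of k] by (simp add: q_def pos_divide_le_eq)
  then have q: "q \<longlonglongrightarrow> 0"
    by (intro Lim_null_comparison[OF _ \<epsilon>]) auto
  define w where "w = A u"
  \<comment> \<open>The difference quotient of the feasible points \<open>y k\<close> at
    \<open>F xbar\<close>, split by order in \<open>t k\<close>.\<close>
  define W where "W k = A (v k) + t k *\<^sub>R (P k + q k)" for k
  have y_W: "y k = F xbar + t k *\<^sub>R W k" for k
    using t(1)[of k] by (simp add: W_def P_def q_def power2_eq_square algebra_simps)
  have "(\<lambda>k. A (v k)) \<longlonglongrightarrow> w"
    unfolding w_def A_def by (intro tendsto_intros v(2))
  then have "W \<longlonglongrightarrow> w + 0 *\<^sub>R (p + 0)"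
    unfolding W_def by (intro tendsto_intros t(2) P q)
  then have W: "W \<longlonglongrightarrow> w"
    by simp
  have a_le: "a \<bullet> v k \<le> t k * (\<epsilon> k - S k)" for k
  proof -
    have "t k * (a \<bullet> v k) + (t k)\<^sup>2 * S k \<le> \<epsilon> k * (t k)\<^sup>2"
      using f_le[of k] t(1)[of k] by (simp add: S_def)
    then have "t k * (a \<bullet> v k) \<le> t k * (t k * (\<epsilon> k - S k))"
      by (simp add: power2_eq_square algebra_simps)
    then show ?thesis
      using t(1)[of k] by simp
  qed

  obtain \<T> r where \<T>: "finite \<T>" "\<And>Q. Q \<in> \<T> \<Longrightarrow> polyhedron Q" "\<And>Q. Q \<in> \<T> \<Longrightarrow> convex_cone Q"
      and r: "r > 0" "\<And>v. norm v < r \<Longrightarrow> F xbar + v \<in> \<Omega> \<longleftrightarrow> v \<in> \<Union>\<T>"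
    using union_of_polyhedra_locally_cone[OF assms(3)] by metis
  define T where "T = \<Union>\<T>"
  note r_T = r(2)[folded T_def]
  have T_scale: "c *\<^sub>R v \<in> T" if "c \<ge> 0" "v \<in> T" for c v
    using that \<T>(3) convex_cone_scaleR unfolding T_def by blast
  have T: "closed T" "finite_union_of_polyhedra T"
    using \<T> polyhedron_imp_closed by (auto simp: T_def finite_union_of_polyhedra_def)
  have cont: "contingent_cone (F xbar) \<Omega> = T"
    using r_T r(1) T(1) T_scale by (rule contingent_cone_local_cone)
  have "u \<in> linearized_cone F \<Omega> xbar"
    using t W[unfolded w_def] y feasible unfolding linearized_cone_def contingent_cone_def jac
    by (intro CollectI conjI exI[of _ t] exI[of _ W]) (auto simp: y_W)
  then have w: "w \<in> T"
    unfolding linearized_cone_def cont jac w_def by simp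
  have critical: "d \<in> critical_cone f F \<Omega> xbar \<longleftrightarrow> A d \<in> T \<and> a \<bullet> d \<le> 0" for d
    by (simp add: critical_cone_def linearized_cone_def cont jac a_def)
  \<comment> \<open>A descent direction here would be critical, but its multiplier \<open>m\<close>
    is orthogonal to \<open>A d\<close>, so stationarity forces
    \<open>a \<bullet> d = 0\<close>.\<close>
  have a_nonneg: "a \<bullet> d \<ge> 0" if "A d \<in> T" for d
  proof (rule ccontr)
    assume less: "\<not> a \<bullet> d \<ge> 0"
    then have "d \<in> critical_cone f F \<Omega> xbar"
      using that critical by simp
    then obtain m where "m \<in> multipliers f F \<Omega> xbar d"
      using assms(4) unfolding extended_M_stationary_def by blast
    then have m: "m \<in> directional_normal_cone (F xbar) \<Omega> (A d)"
        "grad (\<lambda>y. lagrangian f F y 1 m) xbar = 0"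
      by (auto simp: multipliers_def jac)
    have "m \<bullet> A d = 0"
      using assms(3) m(1) by (rule directional_normal_orthogonal)
    then show False
      using less grad_L[of m d] m(2) by simp
  qed
  have "a \<bullet> u \<le> 0 * (0 - s)"
    using a_le by (intro LIMSEQ_le[OF tendsto_inner[OF tendsto_const v(2)]
          tendsto_mult[OF t(2) tendsto_diff[OF \<epsilon> S]]]) auto
  then have au: "a \<bullet> u = 0"
    using a_nonneg[of u] w by (simp add: w_def)
  then have u: "u \<in> critical_cone f F \<Omega> xbar"
    using critical w by (simp add: w_def)

  \<comment> \<open>Second localization: the cone \<open>T\<close> is itself examined near
    \<open>w\<close>.\<close>
  obtain \<K> r' where \<K>: "finite \<K>" "\<And>Q. Q \<in> \<K> \<Longrightarrow> polyhedron Q" "\<And>Q. Q \<in> \<K> \<Longrightarrow> convex_cone Q"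
      and r': "r' > 0" "\<And>v. norm v < r' \<Longrightarrow> w + v \<in> T \<longleftrightarrow> v \<in> \<Union>\<K>"
    using union_of_polyhedra_locally_cone[OF T(2)] by metis
  have K_scale: "c *\<^sub>R v \<in> \<Union>\<K>" if "c > 0" "v \<in> \<Union>\<K>" for c v
    using that \<K>(3) convex_cone_scaleR less_imp_le by blast
  \<comment> \<open>A small step from \<open>u\<close> along \<open>z\<close> stays in the
    linearized cone, and \<open>a \<bullet> u = 0\<close> leaves only the sign of
    \<open>a \<bullet> z\<close>.\<close>
  have a_nonneg_K: "a \<bullet> z \<ge> 0" if z: "A z \<in> \<Union>\<K>" for z
  proof -
    define c where "c = r' / (norm (A z) + 1)"
    have pos: "norm (A z) + 1 > 0"
      by (simp add: add_nonneg_pos)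
    then have c: "c > 0" "norm (c *\<^sub>R A z) < r'"
      using r'(1) by (auto simp: c_def field_simps)
    have "c *\<^sub>R A z \<in> \<Union>\<K>"
      using c(1) z by (rule K_scale)
    then have "A (u + c *\<^sub>R z) \<in> T"
      using r'(2)[OF c(2)] by (simp add: w_def linear_add[OF A] linear_scale[OF A])
    then have "a \<bullet> (u + c *\<^sub>R z) \<ge> 0"
      by (rule a_nonneg)
    then show ?thesis
      using au c(1) by (simp add: inner_add_right zero_le_mult_iff)
  qed
  have approx: "\<exists>z b. norm b < \<delta> \<and> A z + p - b \<in> \<Union>\<K> \<and> a \<bullet> z + s < \<delta>" if "\<delta> > 0" for \<delta>
  proof -
    have "(\<lambda>k. p - P k - q k) \<longlonglongrightarrow> p - p - 0"
      by (intro tendsto_diff tendsto_const P q)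
    then have "\<forall>\<^sub>F k in sequentially. dist (p - P k - q k) 0 < \<delta>"
      using tendstoD that by fastforce
    moreover have "(\<lambda>k. \<epsilon> k - S k + s) \<longlonglongrightarrow> 0 - s + s"
      by (intro tendsto_add tendsto_diff tendsto_const \<epsilon> S)
    then have "\<forall>\<^sub>F k in sequentially. \<epsilon> k - S k + s < \<delta>"
      using that by (intro order_tendstoD) auto
    moreover have "\<forall>\<^sub>F k in sequentially. dist (W k) w < r'"
      using tendstoD[OF W r'(1)] .
    moreover have "(\<lambda>k. t k *\<^sub>R W k) \<longlonglongrightarrow> 0 *\<^sub>R w"
      by (intro tendsto_scaleR t(2) W)
    then have "\<forall>\<^sub>F k in sequentially. dist (t k *\<^sub>R W k) 0 < r"
      using tendstoD r(1) by fastforce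
    ultimately have "\<forall>\<^sub>F k in sequentially. dist (p - P k - q k) 0 < \<delta> \<and> \<epsilon> k - S k + s < \<delta> \<and>
        dist (W k) w < r' \<and> dist (t k *\<^sub>R W k) 0 < r"
      by eventually_elim blast
    then obtain k where k: "norm (p - P k - q k) < \<delta>" "\<epsilon> k - S k + s < \<delta>"
        "norm (W k - w) < r'" "norm (t k *\<^sub>R W k) < r"
      unfolding eventually_sequentially by (auto simp: dist_norm)
    \<comment> \<open>Dividing \<open>W k - w\<close> by \<open>t k\<close> gives
      \<open>A z + P k + q k\<close>, which differs from \<open>A z + p\<close> by the vanishing
      residual \<open>p - P k - q k\<close>; likewise \<open>a_le\<close> bounds
      \<open>a \<bullet> z\<close> by a quantity tending to \<open>- s\<close>.\<close>
    define z where "z = (1 / t k) *\<^sub>R (v k - u)"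
    have "t k *\<^sub>R W k \<in> T"
      using r_T[OF k(4)] y[of k] by (simp add: y_W)
    then have "(1 / t k) *\<^sub>R (t k *\<^sub>R W k) \<in> T"
      by (rule T_scale[rotated]) (use t(1)[of k] in simp)
    moreover have "(1 / t k) *\<^sub>R (t k *\<^sub>R W k) = w + (W k - w)"
      using t(1)[of k] by simp
    ultimately have "W k - w \<in> \<Union>\<K>"
      using r'(2)[OF k(3)] by simp
    then have "(1 / t k) *\<^sub>R (W k - w) \<in> \<Union>\<K>"
      by (rule K_scale[rotated]) (use t(1)[of k] in simp)
    moreover have "(1 / t k) *\<^sub>R (W k - w) = A z + p - (p - P k - q k)"
      using t(1)[of k] by (simp add: z_def W_def w_def linear_scale[OF A] linear_diff[OF A] algebra_simps)
    moreover have "a \<bullet> z = (1 / t k) * (a \<bullet> v k)"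
      using au by (simp add: z_def inner_diff_right)
    then have "t k * (a \<bullet> z) \<le> t k * (\<epsilon> k - S k)"
      using a_le[of k] t(1)[of k] by simp
    then have "a \<bullet> z \<le> \<epsilon> k - S k"
      using t(1)[of k] by simp
    ultimately show ?thesis
      using k(1,2) by (intro exI[of _ z] exI[of _ "p - P k - q k"]) auto
  qed
  obtain k l where l: "l \<in> frechet_normal_cone k (\<Union>\<K>)" "\<And>z. a \<bullet> z + l \<bullet> A z = 0" "l \<bullet> p + s \<le> 0"
    using disjunctive_multiplier[OF A \<K> a_nonneg_K approx] by blast
  have "l \<in> directional_normal_cone (F xbar) \<Omega> w"
    by (rule directional_normal_of_local_cones[OF r_T r(1) T_scale[OF less_imp_le] r'(2,1) K_scale l(1)])
  moreover have "grad (\<lambda>y. lagrangian f F y 1 l) xbar = 0"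
    using grad_L[of l] l(2) by (subst inner_eq_zero_iff[symmetric]) simp
  ultimately have l_mult: "l \<in> multipliers f F \<Omega> xbar u"
    by (simp add: multipliers_def jac w_def)
  \<comment> \<open>The left side is twice \<open>s + l \<bullet> p\<close>, which the choice of
    \<open>l\<close> made nonpositive.\<close>
  have "Df u u + l \<bullet> DF u u > 0"
    using assms(7)[OF u \<open>u \<noteq> 0\<close> l_mult] unfolding lagrangian_hessian_inner[OF f F] .
  then show False
    using l(3) unfolding s_def p_def inner_scaleR_right by linarith
qed

end
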